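(* For any $P\in\mathcal{P}$, either all groups in $\mathcal{G}_P$ are sofic or else the generic group in $\mathcal{G}_P$ is nonsofic, i.e. there is a comeager subset of $\mathcal{G}_P$ consisting of nonsofic groups.
   Context: An enumerated group is a group whose underlying set is $\mathbf{N}=\{1,2,3,\ldots\}$. The set $\mathcal{G}$ of enumerated groups is identified, via (multiplication, inversion, identity), with a subset of $\mathbf{N}^{\mathbf{N}\times\mathbf{N}}\times\mathbf{N}^{\mathbf{N}}\times\mathbf{N}$ (product topology, $\mathbf{N}$ discrete) and given the subspace topology; it is a Polish space. For a property $P$ of groups, $\mathcal{G}_P\subset\mathcal{G}$ is the subspace of enumerated groups satisfying $P$. A subset of a space is comeager if it contains a countable intersection of dense open subsets of that space. $\mathcal{P}$ is the following set of properties of groups: amenability; having no subgroup isomorphic to the free group $\mathbf{F}_2$; left orderability (existence of a left-invariant total order); local indicability (every nontrivial finitely generated subgroup has an infinite cyclic quotient); biorderability (existence of a total order invariant under left and right translation); the unique product property (for all nonempty finite subsets $X,Y$ there is an element that can be written as $xy$ with $x\in X,y\in Y$ in exactly one way); torsion-freeness; soficity; not satisfying a law (for every nontrivial freely reduced word $w$ there is a tuple $\vec a$ in the group with $w(\vec a)\neq e$). For each $P\in\mathcal{P}$ the space $\mathcal{G}_P$ is Polish. Soficity: let $G$ be a finitely generated group with finite symmetric generating set $S$. A finite directed graph $\Gamma$ with edges labeled by elements of $S$ is an $n$-approximation of the Cayley graph $Cay(G,S)$ if there is $W\subseteq V(\Gamma)$ with $|W|>(1-\frac1n)|V(\Gamma)|$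 such that for every $p\in W$ the $n$-neighborhood of $p$ is rooted isomorphic, as an edge-labeled graph, to the $n$-neighborhood of a vertex of $Cay(G,S)$. A finitely generated group $G$ is sofic if for some (equivalently, any) such $S$ and every $n>1$ there is a finite graph that is an $n$-approximation of $Cay(G,S)$. An arbitrary group is sofic if all its finitely generated subgroups are. *)

theory Defs
  imports "HOL-Analysis.Analysis" "HOL-Algebra.Elementary_Groups"
begin

section \<open>Words and free groups\<close>

text \<open>The letter \<open>(x, True)\<close> is the generator \<open>x\<close>, and \<open>(x, False)\<close> is its formal inverse.\<close>

type_synonym 'x word = "('x \<times> bool) list"

definition inv_letter :: "'x \<times> bool \<Rightarrow> 'x \<times> bool" where
  "inv_letter l = (fst l, \<not> snd l)"

definition freely_reduced :: "'x word \<Rightarrow> bool" where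
  "freely_reduced w \<longleftrightarrow> successively (\<lambda>k l. l \<noteq> inv_letter k) w"

fun cancel_cons :: "'x \<times> bool \<Rightarrow> 'x word \<Rightarrow> 'x word" where
  "cancel_cons k [] = [k]"
| "cancel_cons k (l # w) = (if l = inv_letter k then w else k # l # w)"

definition free_group :: "'x set \<Rightarrow> 'x word monoid" where
  "free_group X =
     \<lparr>carrier = {w. freely_reduced w \<and> fst ` set w \<subseteq> X},
      mult = (\<lambda>u v. foldr cancel_cons u v),
      one = []\<rparr>"

abbreviation F\<^sub>2 :: "nat word monoid" where
  "F\<^sub>2 \<equiv> free_group {1, 2}"

definition word_eval :: "('a, 'm) monoid_scheme \<Rightarrow> ('x \<Rightarrow> 'a) \<Rightarrow> 'x word \<Rightarrow> 'a" where
  "word_eval G a w =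
     foldr (\<lambda>(x, pos) g. (if pos then a x else inv\<^bsub>G\<^esub> (a x)) \<otimes>\<^bsub>G\<^esub> g) w \<one>\<^bsub>G\<^esub>"


section \<open>Properties of groups\<close>

text \<open>
  Amenability of the discrete group \<open>G\<close>: there is a left-invariant mean on the bounded real
  functions on \<open>G\<close>. Functions are total on the type \<open>'a\<close>, but linearity and positivity make
  \<open>\<mu> f\<close> depend only on the restriction of \<open>f\<close> to the carrier.
\<close>

definition bounded_on :: "'a set \<Rightarrow> ('a \<Rightarrow> real) \<Rightarrow> bool" where
  "bounded_on A f \<longleftrightarrow> bounded (f ` A)"

definition left_invariant_mean ::
    "('a, 'm) monoid_scheme \<Rightarrow> (('a \<Rightarrow> real) \<Rightarrow> real) \<Rightarrow> bool" where
  "left_invariant_mean G \<mu> \<longleftrightarrow>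
     (\<forall>f h. bounded_on (carrier G) f \<longrightarrow> bounded_on (carrier G) h \<longrightarrow>
        \<mu> (\<lambda>x. f x + h x) = \<mu> f + \<mu> h) \<and>
     (\<forall>c f. bounded_on (carrier G) f \<longrightarrow> \<mu> (\<lambda>x. c * f x) = c * \<mu> f) \<and>
     (\<forall>f. bounded_on (carrier G) f \<longrightarrow> (\<forall>x\<in>carrier G. 0 \<le> f x) \<longrightarrow> 0 \<le> \<mu> f) \<and>
     \<mu> (\<lambda>x. 1) = 1 \<and>
     (\<forall>g\<in>carrier G. \<forall>f. bounded_on (carrier G) f \<longrightarrow> \<mu> (\<lambda>x. f (g \<otimes>\<^bsub>G\<^esub> x)) = \<mu> f)"

definition amenable :: "('a, 'm) monoid_scheme \<Rightarrow> bool" where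
  "amenable G \<longleftrightarrow> (\<exists>\<mu>. left_invariant_mean G \<mu>)"

definition no_free_subgroup :: "('a, 'm) monoid_scheme \<Rightarrow> bool" where
  "no_free_subgroup G \<longleftrightarrow> \<not> (\<exists>H. subgroup H G \<and> G\<lparr>carrier := H\<rparr> \<cong> F\<^sub>2)"

definition left_invariant_rel :: "('a, 'm) monoid_scheme \<Rightarrow> 'a rel \<Rightarrow> bool" where
  "left_invariant_rel G r \<longleftrightarrow>
     (\<forall>g\<in>carrier G. \<forall>x y. (x, y) \<in> r \<longrightarrow> (g \<otimes>\<^bsub>G\<^esub> x, g \<otimes>\<^bsub>G\<^esub> y) \<in> r)"

definition right_invariant_rel :: "('a, 'm) monoid_scheme \<Rightarrow> 'a rel \<Rightarrow> bool" where
  "right_invariant_rel G r \<longleftrightarrow>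
     (\<forall>g\<in>carrier G. \<forall>x y. (x, y) \<in> r \<longrightarrow> (x \<otimes>\<^bsub>G\<^esub> g, y \<otimes>\<^bsub>G\<^esub> g) \<in> r)"

definition left_orderable :: "('a, 'm) monoid_scheme \<Rightarrow> bool" where
  "left_orderable G \<longleftrightarrow> (\<exists>r. linear_order_on (carrier G) r \<and> left_invariant_rel G r)"

definition biorderable :: "('a, 'm) monoid_scheme \<Rightarrow> bool" where
  "biorderable G \<longleftrightarrow>
     (\<exists>r. linear_order_on (carrier G) r \<and> left_invariant_rel G r \<and> right_invariant_rel G r)"

definition locally_indicable :: "('a, 'm) monoid_scheme \<Rightarrow> bool" where
  "locally_indicable G \<longleftrightarrow>
     (\<forall>T. finite T \<longrightarrow> T \<subseteq> carrier G \<longrightarrow> \<not> trivial_group (subgroup_generated G T) \<longrightarrow>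
        (\<exists>N. N \<lhd> subgroup_generated G T \<and> (subgroup_generated G T) Mod N \<cong> integer_group))"

definition unique_product :: "('a, 'm) monoid_scheme \<Rightarrow> bool" where
  "unique_product G \<longleftrightarrow>
     (\<forall>X Y. finite X \<longrightarrow> X \<noteq> {} \<longrightarrow> X \<subseteq> carrier G \<longrightarrow>
            finite Y \<longrightarrow> Y \<noteq> {} \<longrightarrow> Y \<subseteq> carrier G \<longrightarrow>
        (\<exists>g. \<exists>!p. p \<in> X \<times> Y \<and> fst p \<otimes>\<^bsub>G\<^esub> snd p = g))"

definition torsion_free :: "('a, 'm) monoid_scheme \<Rightarrow> bool" where
  "torsion_free G \<longleftrightarrow>
     (\<forall>x\<in>carrier G. \<forall>n::nat. 0 < n \<longrightarrow> x [^]\<^bsub>G\<^esub> n = \<one>\<^bsub>G\<^esub> \<longrightarrow> x = \<one>\<^bsub>G\<^esub>)"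

definition satisfies_no_law :: "('a, 'm) monoid_scheme \<Rightarrow> bool" where
  "satisfies_no_law G \<longleftrightarrow>
     (\<forall>w :: nat word. freely_reduced w \<longrightarrow> w \<noteq> [] \<longrightarrow>
        (\<exists>a. (\<forall>i. a i \<in> carrier G) \<and> word_eval G a w \<noteq> \<one>\<^bsub>G\<^esub>))"


section \<open>Soficity\<close>

record ('v, 'l) labelled_digraph =
  vertices :: "'v set"
  edges :: "('v \<times> 'l \<times> 'v) set"

definition graph_labelled_by :: "'l set \<Rightarrow> ('v, 'l) labelled_digraph \<Rightarrow> bool" where
  "graph_labelled_by L \<Gamma> \<longleftrightarrow> edges \<Gamma> \<subseteq> vertices \<Gamma> \<times> L \<times> vertices \<Gamma>"

definition adjacency :: "('v, 'l) labelled_digraph \<Rightarrow> 'v rel" where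
  "adjacency \<Gamma> = {(u, v). \<exists>s. (u, s, v) \<in> edges \<Gamma> \<or> (v, s, u) \<in> edges \<Gamma>}"

text \<open>
  The \<open>n\<close>-neighbourhood of \<open>p\<close> is the induced subgraph on the vertices joined to \<open>p\<close> by a path of
  length at most \<open>n\<close>; paths may traverse edges in either direction.
\<close>

definition neighbourhood ::
    "('v, 'l) labelled_digraph \<Rightarrow> nat \<Rightarrow> 'v \<Rightarrow> ('v, 'l) labelled_digraph" where
  "neighbourhood \<Gamma> n p =
     (let B = {q \<in> vertices \<Gamma>. \<exists>k\<le>n. (p, q) \<in> adjacency \<Gamma> ^^ k}
      in \<lparr>vertices = B, edges = {(u, s, v) \<in> edges \<Gamma>. u \<in> B \<and> v \<in> B}\<rparr>)"

definition rooted_isomorphic ::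
    "('v, 'l) labelled_digraph \<Rightarrow> 'v \<Rightarrow> ('w, 'l) labelled_digraph \<Rightarrow> 'w \<Rightarrow> bool" where
  "rooted_isomorphic \<Gamma> p \<Delta> q \<longleftrightarrow>
     (\<exists>f. bij_betw f (vertices \<Gamma>) (vertices \<Delta>) \<and> f p = q \<and>
        (\<forall>u\<in>vertices \<Gamma>. \<forall>v\<in>vertices \<Gamma>. \<forall>s.
           (u, s, v) \<in> edges \<Gamma> \<longleftrightarrow> (f u, s, f v) \<in> edges \<Delta>))"

definition Cay :: "('a, 'm) monoid_scheme \<Rightarrow> 'a set \<Rightarrow> ('a, 'a) labelled_digraph" where
  "Cay G S =
     \<lparr>vertices = carrier G, edges = {(g, s, g \<otimes>\<^bsub>G\<^esub> s) | g s. g \<in> carrier G \<and> s \<in> S}\<rparr>"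

definition approximates_Cay ::
    "nat \<Rightarrow> ('v, 'a) labelled_digraph \<Rightarrow> ('a, 'm) monoid_scheme \<Rightarrow> 'a set \<Rightarrow> bool" where
  "approximates_Cay n \<Gamma> G S \<longleftrightarrow>
     (\<exists>W \<subseteq> vertices \<Gamma>.
        real (card W) > (1 - 1 / real n) * real (card (vertices \<Gamma>)) \<and>
        (\<forall>p\<in>W. \<exists>q\<in>vertices (Cay G S).
           rooted_isomorphic (neighbourhood \<Gamma> n p) p (neighbourhood (Cay G S) n q) q))"

definition finite_symmetric_generating_set ::
    "('a, 'm) monoid_scheme \<Rightarrow> 'a set \<Rightarrow> bool" where
  "finite_symmetric_generating_set G S \<longleftrightarrow>
     finite S \<and> S \<subseteq> carrier G \<and> (\<forall>s\<in>S. inv\<^bsub>G\<^esub> s \<in> S) \<and> generate G S = carrier G"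

text \<open>
  Soficity of a finitely generated group. Up to isomorphism every finite graph has its vertices
  in \<open>nat\<close>.
\<close>

definition fg_sofic :: "('a, 'm) monoid_scheme \<Rightarrow> bool" where
  "fg_sofic G \<longleftrightarrow>
     (\<exists>S. finite_symmetric_generating_set G S \<and>
        (\<forall>n>1. \<exists>\<Gamma> :: (nat, 'a) labelled_digraph.
           finite (vertices \<Gamma>) \<and> graph_labelled_by S \<Gamma> \<and> approximates_Cay n \<Gamma> G S))"

definition sofic :: "('a, 'm) monoid_scheme \<Rightarrow> bool" where
  "sofic G \<longleftrightarrow>
     (\<forall>T. finite T \<longrightarrow> T \<subseteq> carrier G \<longrightarrow> fg_sofic (subgroup_generated G T))"


section \<open>Spaces of enumerated groups\<close>

text \<open>
  Points are triples (multiplication, inversion, identity) on the positive integers \<open>{1..}\<close>;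
  elements of the product topologies are extensional functions, \<open>undefined\<close> off the index set.
\<close>

type_synonym enum_structure = "(nat \<times> nat \<Rightarrow> nat) \<times> (nat \<Rightarrow> nat) \<times> nat"

definition structure_space :: "enum_structure topology" where
  "structure_space =
     prod_topology (product_topology (\<lambda>_. discrete_topology {1..}) ({1..} \<times> {1..}))
       (prod_topology (product_topology (\<lambda>_. discrete_topology {1..}) {1..})
         (discrete_topology {1..}))"

definition group_of :: "enum_structure \<Rightarrow> nat monoid" where
  "group_of = (\<lambda>(m, i, e). \<lparr>carrier = {1..}, mult = (\<lambda>x y. m (x, y)), one = e\<rparr>)"

definition enumerated_groups :: "enum_structure set" where
  "enumerated_groups =
     {(m, i, e) \<in> topspace structure_space.
        group (group_of (m, i, e)) \<and> (\<forall>x\<in>{1..}. i x = inv\<^bsub>group_of (m, i, e)\<^esub> x)}"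

definition enumerated_groups_space :: "(nat monoid \<Rightarrow> bool) \<Rightarrow> enum_structure topology" where
  "enumerated_groups_space P =
     subtopology structure_space {\<omega> \<in> enumerated_groups. P (group_of \<omega>)}"

definition comeager_in :: "'a topology \<Rightarrow> 'a set \<Rightarrow> bool" where
  "comeager_in X C \<longleftrightarrow>
     C \<subseteq> topspace X \<and>
     (\<exists>\<U>. countable \<U> \<and> (\<forall>U\<in>\<U>. openin X U \<and> X closure_of U = topspace X) \<and>
          topspace X \<inter> \<Inter>\<U> \<subseteq> C)"

definition group_properties :: "('a monoid \<Rightarrow> bool) set" where
  "group_properties =
     {amenable, no_free_subgroup, left_orderable, locally_indicable, biorderable,
      unique_product, torsion_free, sofic, satisfies_no_law}"

end

theory Submission
  imports Defs
begin

text \<open>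
  Let \<open>K\<close> be a nonsofic group with the property \<open>P\<close>. Soficity of a finitely generated group is
  tested on finite balls of its Cayley graph, so the failure of soficity of \<open>K\<close> is witnessed by a
  finite set \<open>B \<subseteq> K\<close>: every group \<open>M\<close> into which the partial multiplication table of \<open>B\<close> embeds is
  nonsofic (\<open>nonsofic_finite_obstruction\<close>). The enumerated groups with the property \<open>P\<close> that
  admit such a partial embedding form an open set, because a given embedding involves finitely many
  values of the multiplication (\<open>openin_partially_embedding\<close>).

  This open set is dense (\<open>dense_partially_embedding\<close>). A basic open set of enumerated groups fixes
  finitely many values of the operations of some group \<open>G\<close> with the property \<open>P\<close>. The product
  \<open>G \<times> K\<close> can be enumerated so that the finitely many relevant \<open>g \<in> G\<close> are the numbers that
  enumerate \<open>(g, 1)\<close>; this enumeration lies in the basic open set, it contains \<open>K\<close>, and it has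
  the property \<open>P\<close>: the existence of \<open>K\<close> shows that \<open>P\<close> is not soficity, and the other
  properties pass to direct products (\<open>group_property_direct_product\<close>). So the open set itself is a
  comeager set of nonsofic groups.

  The delicate point of the first step is that soficity of \<open>\<langle>T\<rangle>\<close> only provides approximations of
  \<open>Cay(\<langle>T\<rangle>, S)\<close> for some generating set \<open>S\<close>, and not for the one over which the words
  in \<open>B\<close> are written. Writing the generators of the one set as words in the other turns an
  approximating graph into the graph whose edges are the walks spelling those words, and a rooted
  isomorphism of large balls induces one of smaller balls in the graphs of walks
  (\<open>walk_graph_rooted_isomorphic\<close>). As the new labels are arbitrary, the same construction also
  transports approximations along the partial embedding.
\<close>

section \<open>Graphs of walks\<close>

abbreviation ball_at :: "('v, 'l) labelled_digraph \<Rightarrow> nat \<Rightarrow> 'v \<Rightarrow> 'v set" where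
  "ball_at \<Gamma> r p \<equiv> vertices (neighbourhood \<Gamma> r p)"

lemma mem_ball_at:
  "v \<in> ball_at \<Gamma> r p \<longleftrightarrow> v \<in> vertices \<Gamma> \<and> (\<exists>k\<le>r. (p, v) \<in> adjacency \<Gamma> ^^ k)"
  by (simp add: neighbourhood_def Let_def)

lemma edges_neighbourhood:
  "(u, s, v) \<in> edges (neighbourhood \<Gamma> r p) \<longleftrightarrow>
     (u, s, v) \<in> edges \<Gamma> \<and> u \<in> ball_at \<Gamma> r p \<and> v \<in> ball_at \<Gamma> r p"
  by (auto simp: neighbourhood_def Let_def)

lemma ball_at_mono: "v \<in> ball_at \<Gamma> r p \<Longrightarrow> r \<le> r' \<Longrightarrow> v \<in> ball_at \<Gamma> r' p"
  unfolding mem_ball_at by (meson order_trans)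

lemma root_in_ball_at: "p \<in> vertices \<Gamma> \<Longrightarrow> p \<in> ball_at \<Gamma> r p"
  by (force simp: mem_ball_at intro: exI[of _ 0])

lemma ball_at_step:
  assumes "u \<in> ball_at \<Gamma> r p" and "(u, v) \<in> adjacency \<Gamma>" and "v \<in> vertices \<Gamma>"
  shows "v \<in> ball_at \<Gamma> (Suc r) p"
proof -
  obtain k where "k \<le> r" "(p, u) \<in> adjacency \<Gamma> ^^ k"
    using assms(1) by (auto simp: mem_ball_at)
  then have "(p, v) \<in> adjacency \<Gamma> ^^ Suc k"
    using assms(2) by auto
  with \<open>k \<le> r\<close> assms(3) show ?thesis
    unfolding mem_ball_at by (metis Suc_le_mono)
qed

definition rooted_iso_map ::
    "('v \<Rightarrow> 'w) \<Rightarrow> ('v, 'l) labelled_digraph \<Rightarrow> 'v \<Rightarrow> ('w, 'l) labelled_digraph \<Rightarrow> 'w \<Rightarrow> bool" where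
  "rooted_iso_map f \<Gamma> p \<Delta> q \<longleftrightarrow>
     bij_betw f (vertices \<Gamma>) (vertices \<Delta>) \<and> f p = q \<and>
     (\<forall>u\<in>vertices \<Gamma>. \<forall>v\<in>vertices \<Gamma>. \<forall>s. (u, s, v) \<in> edges \<Gamma> \<longleftrightarrow> (f u, s, f v) \<in> edges \<Delta>)"

lemma rooted_isomorphic_iff: "rooted_isomorphic \<Gamma> p \<Delta> q \<longleftrightarrow> (\<exists>f. rooted_iso_map f \<Gamma> p \<Delta> q)"
  by (simp add: rooted_isomorphic_def rooted_iso_map_def)

lemma rooted_iso_map_inverse:
  assumes "rooted_iso_map f \<Gamma> p \<Delta> q" and "p \<in> vertices \<Gamma>"
  shows "rooted_iso_map (inv_into (vertices \<Gamma>) f) \<Delta> q \<Gamma> p"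
proof -
  let ?g = "inv_into (vertices \<Gamma>) f"
  have bij: "bij_betw f (vertices \<Gamma>) (vertices \<Delta>)" and fp: "f p = q"
    and ed: "\<And>u v s. u \<in> vertices \<Gamma> \<Longrightarrow> v \<in> vertices \<Gamma> \<Longrightarrow> (u, s, v) \<in> edges \<Gamma> \<longleftrightarrow> (f u, s, f v) \<in> edges \<Delta>"
    using assms(1) by (auto simp: rooted_iso_map_def)
  have g: "?g x \<in> vertices \<Gamma>" "f (?g x) = x" if "x \<in> vertices \<Delta>" for x
    using that bij by (auto simp: bij_betw_def inv_into_into f_inv_into_f)
  have "?g q = p"
    using bij assms(2) fp by (auto simp: bij_betw_def)
  moreover have "bij_betw ?g (vertices \<Delta>) (vertices \<Gamma>)"
    by (rule bij_betw_inv_into[OF bij])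
  ultimately show ?thesis
    unfolding rooted_iso_map_def using g ed by metis
qed

lemma rooted_iso_map_trans:
  assumes "rooted_iso_map f \<Gamma> p \<Delta> q" and "rooted_iso_map g \<Delta> q \<Theta> r"
  shows "rooted_iso_map (g \<circ> f) \<Gamma> p \<Theta> r"
  using assms unfolding rooted_iso_map_def
  by (auto intro: bij_betw_trans simp: bij_betw_apply)

primrec walk :: "('v, 'l) labelled_digraph \<Rightarrow> 'l list \<Rightarrow> 'v \<Rightarrow> 'v \<Rightarrow> bool" where
  "walk \<Gamma> [] u v \<longleftrightarrow> u = v"
| "walk \<Gamma> (l # ls) u v \<longleftrightarrow> (\<exists>x. (u, l, x) \<in> edges \<Gamma> \<and> walk \<Gamma> ls x v)"

text \<open>
  If every label \<open>s \<in> S\<close> is a word in the generators of a group, namely \<open>w s\<close>, then the graph of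
  walks of the Cayley graph is the Cayley graph for the elements spelled by these words. Because
  \<open>S\<close> may have any type, this covers relabellings as well as changes of generating set.
\<close>

definition walk_graph ::
    "'s set \<Rightarrow> ('s \<Rightarrow> 'l list) \<Rightarrow> ('v, 'l) labelled_digraph \<Rightarrow> ('v, 's) labelled_digraph" where
  "walk_graph S w \<Gamma> =
     \<lparr>vertices = vertices \<Gamma>,
      edges = {(u, s, v). u \<in> vertices \<Gamma> \<and> v \<in> vertices \<Gamma> \<and> s \<in> S \<and> walk \<Gamma> (w s) u v}\<rparr>"

lemma vertices_walk_graph [simp]: "vertices (walk_graph S w \<Gamma>) = vertices \<Gamma>"
  by (simp add: walk_graph_def)

lemma edges_walk_graph:
  "(u, s, v) \<in> edges (walk_graph S w \<Gamma>) \<longleftrightarrow>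
     u \<in> vertices \<Gamma> \<and> v \<in> vertices \<Gamma> \<and> s \<in> S \<and> walk \<Gamma> (w s) u v"
  by (simp add: walk_graph_def)

lemma neighbourhood_iso_edge:
  assumes "rooted_iso_map f (neighbourhood \<Gamma> N p) p (neighbourhood \<Delta> N q) q"
    and "(u, l, v) \<in> edges \<Gamma>" and "u \<in> ball_at \<Gamma> N p" and "v \<in> ball_at \<Gamma> N p"
  shows "(f u, l, f v) \<in> edges \<Delta>"
  using assms unfolding rooted_iso_map_def by (metis edges_neighbourhood)

text \<open>
  Each vertex on a walk that starts in the ball of radius \<open>r\<close> stays in the ball of radius
  \<open>r + length ls \<le> N\<close>, so the isomorphism of the \<open>N\<close>-balls maps each of its edges.
\<close>

lemma walk_from_ball:
  assumes f: "rooted_iso_map f (neighbourhood \<Gamma> N p) p (neighbourhood \<Delta> N q) q"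
    and lab: "graph_labelled_by L \<Gamma>"
  shows "walk \<Gamma> ls u v \<Longrightarrow> u \<in> ball_at \<Gamma> r p \<Longrightarrow> r + length ls \<le> N \<Longrightarrow>
     v \<in> ball_at \<Gamma> (r + length ls) p \<and> walk \<Delta> ls (f u) (f v)"
proof (induction ls arbitrary: u r)
  case (Cons l ls)
  then obtain x where x: "(u, l, x) \<in> edges \<Gamma>" "walk \<Gamma> ls x v" by auto
  have "x \<in> ball_at \<Gamma> (Suc r) p"
    using ball_at_step[OF Cons.prems(2), of x] x lab by (auto simp: adjacency_def graph_labelled_by_def)
  moreover have "(f u, l, f x) \<in> edges \<Delta>"
    using neighbourhood_iso_edge[OF f x(1) ball_at_mono[OF Cons.prems(2)] ball_at_mono[OF calculation]]
      Cons.prems(3) by simp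
  ultimately show ?case
    using Cons.IH[OF x(2), of "Suc r"] Cons.prems(3) by auto
qed auto

text \<open>
  Balls are formed with edges of either direction, so the graph of walks needs the transfer from the
  endpoint of a walk as well as from its starting point.
\<close>

lemma walk_into_ball:
  assumes f: "rooted_iso_map f (neighbourhood \<Gamma> N p) p (neighbourhood \<Delta> N q) q"
    and lab: "graph_labelled_by L \<Gamma>"
  shows "walk \<Gamma> ls u v \<Longrightarrow> v \<in> ball_at \<Gamma> r p \<Longrightarrow> r + length ls \<le> N \<Longrightarrow>
     u \<in> ball_at \<Gamma> (r + length ls) p \<and> walk \<Delta> ls (f u) (f v)"
proof (induction ls arbitrary: u)
  case (Cons l ls)
  then obtain x where x: "(u, l, x) \<in> edges \<Gamma>" "walk \<Gamma> ls x v" by auto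
  have *: "x \<in> ball_at \<Gamma> (r + length ls) p" "walk \<Delta> ls (f x) (f v)"
    using Cons.IH[OF x(2)] Cons.prems by auto
  have u: "u \<in> ball_at \<Gamma> (Suc (r + length ls)) p"
    using ball_at_step[OF *(1), of u] x lab by (auto simp: adjacency_def graph_labelled_by_def)
  have "(f u, l, f x) \<in> edges \<Delta>"
    using neighbourhood_iso_edge[OF f x(1) ball_at_mono[OF u] ball_at_mono[OF *(1)]] Cons.prems(3)
    by simp
  with u * show ?case by auto
qed auto

lemma walk_graph_ball:
  assumes f: "rooted_iso_map f (neighbourhood \<Gamma> N p) p (neighbourhood \<Delta> N q) q"
    and lab: "graph_labelled_by L \<Gamma>" and p: "p \<in> vertices \<Gamma>"
    and len: "\<And>s. s \<in> S \<Longrightarrow> length (w s) \<le> m"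
  shows "(p, u) \<in> adjacency (walk_graph S w \<Gamma>) ^^ k \<Longrightarrow> k * m \<le> N \<Longrightarrow>
     u \<in> ball_at \<Gamma> (k * m) p \<and> (q, f u) \<in> adjacency (walk_graph S w \<Delta>) ^^ k"
proof (induction k arbitrary: u)
  case 0
  then show ?case using f p by (auto simp: root_in_ball_at rooted_iso_map_def)
next
  case (Suc k)
  then obtain x where x: "(p, x) \<in> adjacency (walk_graph S w \<Gamma>) ^^ k"
    and adj: "(x, u) \<in> adjacency (walk_graph S w \<Gamma>)" by auto
  have IH: "x \<in> ball_at \<Gamma> (k * m) p" "(q, f x) \<in> adjacency (walk_graph S w \<Delta>) ^^ k"
    using Suc.IH[OF x] Suc.prems by auto
  have image: "f v \<in> vertices \<Delta>" if "v \<in> ball_at \<Gamma> N p" for v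
    using f that by (metis bij_betwE mem_ball_at rooted_iso_map_def)
  obtain s where s: "s \<in> S" "walk \<Gamma> (w s) x u \<or> walk \<Gamma> (w s) u x"
    using adj by (auto simp: adjacency_def edges_walk_graph)
  have le: "k * m + length (w s) \<le> Suc k * m" using len[OF s(1)] by simp
  then have le': "k * m + length (w s) \<le> N" using Suc.prems by linarith
  have "u \<in> ball_at \<Gamma> (k * m + length (w s)) p \<and>
      (walk \<Delta> (w s) (f x) (f u) \<or> walk \<Delta> (w s) (f u) (f x))"
    using s(2) walk_from_ball[OF f lab _ IH(1) le'] walk_into_ball[OF f lab _ IH(1) le'] by blast
  moreover from this have "(f x, f u) \<in> adjacency (walk_graph S w \<Delta>)"
    using s(1) mem_ball_at[of x] mem_ball_at[of u] image[of x] image[of u]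
      ball_at_mono[OF IH(1), of N] ball_at_mono[of u \<Gamma> "k * m + length (w s)" p N] le'
    by (auto simp: adjacency_def edges_walk_graph)
  ultimately show ?case
    using relpow_Suc_I[OF IH(2), of "f u"] ball_at_mono[OF _ le, of u \<Gamma> p] by blast
qed

text \<open>
  Distances grow by a factor of at most \<open>m\<close> on passing from the graph of walks to the underlying
  graph. Hence the \<open>n\<close>-ball of the graph of walks lies in the \<open>n * m\<close>-ball of the underlying graph;
  one further \<open>m\<close> leaves room for the walks that witness the edges between its vertices. The
  restriction of the given isomorphism is onto by the symmetric statement for its inverse.
\<close>

lemma walk_graph_rooted_isomorphic:
  assumes iso: "rooted_isomorphic (neighbourhood \<Gamma> N p) p (neighbourhood \<Delta> N q) q"
    and lab: "graph_labelled_by L \<Gamma>" "graph_labelled_by L' \<Delta>"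
    and p: "p \<in> vertices \<Gamma>" and q: "q \<in> vertices \<Delta>"
    and len: "\<And>s. s \<in> S \<Longrightarrow> length (w s) \<le> m" and N: "Suc n * m \<le> N"
  shows "rooted_isomorphic (neighbourhood (walk_graph S w \<Gamma>) n p) p
           (neighbourhood (walk_graph S w \<Delta>) n q) q"
proof -
  obtain f where f: "rooted_iso_map f (neighbourhood \<Gamma> N p) p (neighbourhood \<Delta> N q) q"
    using iso by (auto simp: rooted_isomorphic_iff)
  define g where "g = inv_into (ball_at \<Gamma> N p) f"
  have g: "rooted_iso_map g (neighbourhood \<Delta> N q) q (neighbourhood \<Gamma> N p) p"
    unfolding g_def by (rule rooted_iso_map_inverse[OF f root_in_ball_at[OF p]])
  let ?\<Gamma> = "walk_graph S w \<Gamma>" and ?\<Delta> = "walk_graph S w \<Delta>"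
  have kN: "k * m \<le> N" if "k \<le> n" for k
    using N that mult_le_mono1[of k "Suc n" m] by linarith
  have bij: "bij_betw f (ball_at \<Gamma> N p) (ball_at \<Delta> N q)"
    using f by (simp add: rooted_iso_map_def)
  have bij': "bij_betw g (ball_at \<Delta> N q) (ball_at \<Gamma> N p)"
    using g by (simp add: rooted_iso_map_def)
  have gf: "g (f u) = u" if "u \<in> ball_at \<Gamma> N p" for u
    using bij that by (simp add: g_def bij_betw_def)
  have fg: "f (g x) = x" if "x \<in> ball_at \<Delta> N q" for x
    using bij that by (simp add: g_def bij_betw_def f_inv_into_f)
  have fw: "f u \<in> ball_at ?\<Delta> n q \<and> u \<in> ball_at \<Gamma> (n * m) p" if u: "u \<in> ball_at ?\<Gamma> n p" for u
  proof -
    obtain k where k: "k \<le> n" "(p, u) \<in> adjacency ?\<Gamma> ^^ k" using u by (auto simp: mem_ball_at)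
    have "u \<in> ball_at \<Gamma> (k * m) p" "(q, f u) \<in> adjacency ?\<Delta> ^^ k"
      using walk_graph_ball[OF f lab(1) p len k(2) kN[OF k(1)]] by auto
    moreover have "f u \<in> vertices \<Delta>"
      using ball_at_mono[OF calculation(1) kN[OF k(1)]] bij_betwE[OF bij] mem_ball_at[of "f u" \<Delta> N q]
      by simp
    ultimately show ?thesis
      using k(1) ball_at_mono[of u \<Gamma> "k * m" p "n * m"] by (auto simp: mem_ball_at[of _ "walk_graph S w _"])
  qed
  have bw: "g x \<in> ball_at ?\<Gamma> n p \<and> x \<in> ball_at \<Delta> (n * m) q" if x: "x \<in> ball_at ?\<Delta> n q" for x
  proof -
    obtain k where k: "k \<le> n" "(q, x) \<in> adjacency ?\<Delta> ^^ k" using x by (auto simp: mem_ball_at)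
    have "x \<in> ball_at \<Delta> (k * m) q" "(p, g x) \<in> adjacency ?\<Gamma> ^^ k"
      using walk_graph_ball[OF g lab(2) q len k(2) kN[OF k(1)]] by auto
    moreover have "g x \<in> vertices \<Gamma>"
      using ball_at_mono[OF calculation(1) kN[OF k(1)]] bij_betwE[OF bij'] mem_ball_at[of "g x" \<Gamma> N p]
      by simp
    ultimately show ?thesis
      using k(1) ball_at_mono[of x \<Delta> "k * m" q "n * m"] by (auto simp: mem_ball_at[of _ "walk_graph S w _"])
  qed
  have sub\<Gamma>: "u \<in> ball_at \<Gamma> N p" if "u \<in> ball_at \<Gamma> (n * m) p" for u
    using ball_at_mono[OF that] kN[of n] by simp
  have sub\<Delta>: "u \<in> ball_at \<Delta> N q" if "u \<in> ball_at \<Delta> (n * m) q" for u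
    using ball_at_mono[OF that] kN[of n] by simp
  have walk_iff: "walk \<Gamma> (w s) u v \<longleftrightarrow> walk \<Delta> (w s) (f u) (f v)"
    if "u \<in> ball_at ?\<Gamma> n p" "v \<in> ball_at ?\<Gamma> n p" "s \<in> S" for u v s
  proof -
    have le: "n * m + length (w s) \<le> N" using len[OF that(3)] N by simp
    show ?thesis
      using walk_from_ball[OF f lab(1) _ _ le] walk_from_ball[OF g lab(2) _ _ le] fw bw that gf sub\<Gamma>
      by metis
  qed
  have "bij_betw f (ball_at ?\<Gamma> n p) (ball_at ?\<Delta> n q)"
  proof (rule bij_betwI[where g = g])
    show "f \<in> ball_at ?\<Gamma> n p \<rightarrow> ball_at ?\<Delta> n q" using fw by simp
    show "g \<in> ball_at ?\<Delta> n q \<rightarrow> ball_at ?\<Gamma> n p" using bw by simp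
    show "g (f u) = u" if "u \<in> ball_at ?\<Gamma> n p" for u using fw[OF that] gf sub\<Gamma> by simp
    show "f (g x) = x" if "x \<in> ball_at ?\<Delta> n q" for x using bw[OF that] fg sub\<Delta> by simp
  qed
  moreover have "f p = q" using f by (simp add: rooted_iso_map_def)
  moreover have "(u, s, v) \<in> edges (neighbourhood ?\<Gamma> n p) \<longleftrightarrow>
      (f u, s, f v) \<in> edges (neighbourhood ?\<Delta> n q)"
    if "u \<in> ball_at ?\<Gamma> n p" "v \<in> ball_at ?\<Gamma> n p" for u v s
  proof -
    have "u \<in> vertices \<Gamma>" "v \<in> vertices \<Gamma>" "f u \<in> vertices \<Delta>" "f v \<in> vertices \<Delta>"
      using that fw[OF that(1)] fw[OF that(2)] by (simp_all add: mem_ball_at)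
    then show ?thesis
      using that fw[OF that(1)] fw[OF that(2)] walk_iff[OF that]
      by (cases "s \<in> S") (simp_all add: edges_neighbourhood edges_walk_graph)
  qed
  ultimately show ?thesis
    unfolding rooted_isomorphic_def by blast
qed

section \<open>A finite obstruction to soficity\<close>

definition list_prod :: "('a, 'm) monoid_scheme \<Rightarrow> 'a list \<Rightarrow> 'a" where
  "list_prod G ws = foldr (mult G) ws \<one>\<^bsub>G\<^esub>"

lemma list_prod_simps [simp]:
  "list_prod G [] = \<one>\<^bsub>G\<^esub>" "list_prod G (x # ws) = x \<otimes>\<^bsub>G\<^esub> list_prod G ws"
  by (simp_all add: list_prod_def)

lemma (in monoid) list_prod_closed [simp]: "set ws \<subseteq> carrier G \<Longrightarrow> list_prod G ws \<in> carrier G"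
  by (induction ws) auto

lemma (in monoid) list_prod_append:
  "set us \<subseteq> carrier G \<Longrightarrow> set vs \<subseteq> carrier G \<Longrightarrow>
     list_prod G (us @ vs) = list_prod G us \<otimes> list_prod G vs"
  by (induction us) (auto simp: m_assoc)

lemma (in group) generate_imp_list_prod:
  assumes S: "S \<subseteq> carrier G" "\<And>s. s \<in> S \<Longrightarrow> inv s \<in> S" and "x \<in> generate G S"
  shows "\<exists>ws. set ws \<subseteq> S \<and> list_prod G ws = x"
  using assms(3)
proof (induction rule: generate.induct)
  case one
  show ?case by (rule exI[of _ "[]"]) simp
next
  case (incl h)
  then show ?case using S by (intro exI[of _ "[h]"]) auto
next
  case (inv h)
  then have "inv h \<in> S" "inv h \<in> carrier G" using S by auto
  then show ?case by (intro exI[of _ "[inv h]"]) simp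
next
  case (eng g h)
  then obtain us vs where "set us \<subseteq> S" "list_prod G us = g" "set vs \<subseteq> S" "list_prod G vs = h"
    by blast
  then show ?case using S by (intro exI[of _ "us @ vs"]) (auto simp: list_prod_append)
qed

lemma vertices_Cay [simp]: "vertices (Cay G S) = carrier G"
  by (simp add: Cay_def)

lemma edges_Cay: "(u, s, v) \<in> edges (Cay G S) \<longleftrightarrow> u \<in> carrier G \<and> s \<in> S \<and> v = u \<otimes>\<^bsub>G\<^esub> s"
  by (auto simp: Cay_def)

lemma (in group) graph_labelled_by_Cay: "S \<subseteq> carrier G \<Longrightarrow> graph_labelled_by S (Cay G S)"
  by (auto simp: Cay_def graph_labelled_by_def)

lemma (in group) walk_Cay:
  assumes "S \<subseteq> carrier G" 
  shows "set ws \<subseteq> S \<Longrightarrow> u \<in> carrier G \<Longrightarrow>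
    walk (Cay G S) ws u v \<longleftrightarrow> v = u \<otimes> list_prod G ws"
proof (induction ws arbitrary: u)
  case (Cons s ws)
  then have "s \<in> carrier G" "list_prod G ws \<in> carrier G" using assms by auto
  then show ?case using Cons by (auto simp: edges_Cay m_assoc)
qed auto

text \<open>
  A map that is injective and multiplicative on the words of length at most \<open>n + 1\<close> in \<open>S\<close>. The
  \<open>n\<close>-ball of \<open>Cay(K, S)\<close> consists of words of length at most \<open>n\<close>; the extra letter lets its edges
  be tested.
\<close>

locale cayley_ball_embedding = K: group K + M: group M
  for K :: "('a, 'm) monoid_scheme" and M :: "('b, 'n) monoid_scheme" +
  fixes S :: "'a set" and n :: nat and t :: "'a \<Rightarrow> 'b" and B :: "'a set"
  defines "B \<equiv> list_prod K ` {ws. set ws \<subseteq> S \<and> length ws \<le> Suc n}"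
  assumes S_closed: "S \<subseteq> carrier K" and S_inv: "\<And>s. s \<in> S \<Longrightarrow> inv\<^bsub>K\<^esub> s \<in> S"
    and t_closed: "\<And>x. x \<in> B \<Longrightarrow> t x \<in> carrier M" and t_inj: "inj_on t B"
    and t_mult: "\<And>x y. x \<in> B \<Longrightarrow> y \<in> B \<Longrightarrow> x \<otimes>\<^bsub>K\<^esub> y \<in> B \<Longrightarrow> t (x \<otimes>\<^bsub>K\<^esub> y) = t x \<otimes>\<^bsub>M\<^esub> t y"
begin

lemma B_I: "set ws \<subseteq> S \<Longrightarrow> length ws \<le> Suc n \<Longrightarrow> list_prod K ws \<in> B"
  by (auto simp: B_def)

lemma one_in_B: "\<one>\<^bsub>K\<^esub> \<in> B"
  using B_I[of "[]"] by simp

lemma S_subset_B: "s \<in> S \<Longrightarrow> s \<in> B"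
  using B_I[of "[s]"] S_closed by auto

lemma t_one: "t \<one>\<^bsub>K\<^esub> = \<one>\<^bsub>M\<^esub>"
proof -
  have "t \<one>\<^bsub>K\<^esub> \<otimes>\<^bsub>M\<^esub> t \<one>\<^bsub>K\<^esub> = t \<one>\<^bsub>K\<^esub>"
    using t_mult[OF one_in_B one_in_B] one_in_B by simp
  then show ?thesis using t_closed[OF one_in_B] by (metis M.l_cancel_one)
qed

lemma t_inv: "s \<in> S \<Longrightarrow> t (inv\<^bsub>K\<^esub> s) = inv\<^bsub>M\<^esub> t s"
proof -
  assume s: "s \<in> S"
  then have "t (inv\<^bsub>K\<^esub> s) \<otimes>\<^bsub>M\<^esub> t s = \<one>\<^bsub>M\<^esub>"
    using t_mult[of "inv\<^bsub>K\<^esub> s" s] S_subset_B S_inv S_closed t_one one_in_B by (auto simp: subset_iff)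
  then show ?thesis
    using M.inv_equality[symmetric] t_closed S_subset_B S_inv s by metis
qed

lemma adjacency_Cay:
  "(x, y) \<in> adjacency (Cay K S) \<longleftrightarrow> x \<in> carrier K \<and> (\<exists>s\<in>S. y = x \<otimes>\<^bsub>K\<^esub> s)"
proof -
  have "x = y \<otimes>\<^bsub>K\<^esub> s \<longleftrightarrow> y = x \<otimes>\<^bsub>K\<^esub> inv\<^bsub>K\<^esub> s" if "x \<in> carrier K" "y \<in> carrier K" "s \<in> S" for s
    using that S_closed by (metis K.inv_solve_right subsetD)
  then show ?thesis
    using S_inv S_closed unfolding adjacency_def edges_Cay mem_Collect_eq split_conv
    by (metis K.m_closed K.inv_closed K.inv_inv subsetD)
qed

lemma Cay_ball_words:
  "(\<one>\<^bsub>K\<^esub>, b) \<in> adjacency (Cay K S) ^^ k \<Longrightarrow> \<exists>ws. set ws \<subseteq> S \<and> length ws = k \<and> b = list_prod K ws"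
proof (induction k arbitrary: b)
  case (Suc k)
  then obtain c where c: "(\<one>\<^bsub>K\<^esub>, c) \<in> adjacency (Cay K S) ^^ k" "(c, b) \<in> adjacency (Cay K S)"
    by auto
  then obtain ws s where "set ws \<subseteq> S" "length ws = k" "c = list_prod K ws" "s \<in> S" "b = c \<otimes>\<^bsub>K\<^esub> s"
    using Suc.IH by (metis adjacency_Cay)
  then show ?case
    using S_closed by (intro exI[of _ "ws @ [s]"]) (auto simp: K.list_prod_append subset_trans[of _ S] subsetD)
qed auto

lemma Cay_ball_in_B: "(\<one>\<^bsub>K\<^esub>, b) \<in> adjacency (Cay K S) ^^ k \<Longrightarrow> k \<le> Suc n \<Longrightarrow> b \<in> B"
  using Cay_ball_words B_I by metis

lemma Cay_ball_step:
  assumes "(\<one>\<^bsub>K\<^esub>, b) \<in> adjacency (Cay K S) ^^ k" and "k \<le> n" and "s \<in> S"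
  shows "b \<otimes>\<^bsub>K\<^esub> s \<in> B" and "t (b \<otimes>\<^bsub>K\<^esub> s) = t b \<otimes>\<^bsub>M\<^esub> t s"
    and "(\<one>\<^bsub>K\<^esub>, b \<otimes>\<^bsub>K\<^esub> s) \<in> adjacency (Cay K S) ^^ Suc k" 
proof -
  have "b \<in> carrier K"
    using Cay_ball_words[OF assms(1)] S_closed by auto
  then have "(b, b \<otimes>\<^bsub>K\<^esub> s) \<in> adjacency (Cay K S)"
    using assms(3) by (auto simp: adjacency_Cay)
  with assms(1) show *: "(\<one>\<^bsub>K\<^esub>, b \<otimes>\<^bsub>K\<^esub> s) \<in> adjacency (Cay K S) ^^ Suc k" by auto
  show b: "b \<otimes>\<^bsub>K\<^esub> s \<in> B" using Cay_ball_in_B[OF *] assms(2) by simp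
  show "t (b \<otimes>\<^bsub>K\<^esub> s) = t b \<otimes>\<^bsub>M\<^esub> t s"
    using t_mult[OF _ _ b] Cay_ball_in_B[OF assms(1)] S_subset_B assms by simp
qed

text \<open>
  A left translate \<open>b \<mapsto> q t(b)\<close> of the partial embedding carries the \<open>n\<close>-ball around the
  identity to the \<open>n\<close>-ball around \<open>q\<close>, for the Cayley graph of \<open>M\<close> in which the edges of \<open>t s\<close> are
  labelled \<open>s\<close>.
\<close>

lemma Cay_ball_iso:
  assumes V: "vertices D = carrier M"
    and E: "\<And>u s v. (u, s, v) \<in> edges D \<longleftrightarrow> u \<in> carrier M \<and> s \<in> S \<and> v = u \<otimes>\<^bsub>M\<^esub> t s"
    and q: "q \<in> carrier M"
  shows "rooted_isomorphic (neighbourhood D n q) q (neighbourhood (Cay K S) n \<one>\<^bsub>K\<^esub>) \<one>\<^bsub>K\<^esub>"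
proof -
  let ?A = "adjacency (Cay K S)" and ?f = "\<lambda>b. q \<otimes>\<^bsub>M\<^esub> t b"
  have tS: "t s \<in> carrier M" if "s \<in> S" for s using that t_closed S_subset_B by blast
  have adjD: "(x, y) \<in> adjacency D \<longleftrightarrow> x \<in> carrier M \<and> (\<exists>s\<in>S. y = x \<otimes>\<^bsub>M\<^esub> t s)" for x y
  proof -
    have "x = y \<otimes>\<^bsub>M\<^esub> t s \<longleftrightarrow> y = x \<otimes>\<^bsub>M\<^esub> t (inv\<^bsub>K\<^esub> s)"
      if "x \<in> carrier M" "y \<in> carrier M" "s \<in> S" for s
      using that tS by (metis M.inv_solve_right t_inv)
    then show ?thesis
      using S_inv tS unfolding adjacency_def E mem_Collect_eq split_conv
      by (metis M.m_closed K.inv_inv S_closed subsetD)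
  qed
  have forth: "(\<one>\<^bsub>K\<^esub>, b) \<in> ?A ^^ k \<Longrightarrow> k \<le> n \<Longrightarrow> (q, ?f b) \<in> adjacency D ^^ k" for b k
  proof (induction k arbitrary: b)
    case 0
    then show ?case using q t_one by auto
  next
    case (Suc k)
    then obtain c s where c: "(\<one>\<^bsub>K\<^esub>, c) \<in> ?A ^^ k" "s \<in> S" "b = c \<otimes>\<^bsub>K\<^esub> s"
      by (metis adjacency_Cay relpow_Suc_E)
    have "t c \<in> carrier M" using Cay_ball_in_B[OF c(1)] Suc.prems t_closed by simp
    then have "(?f c, ?f b) \<in> adjacency D"
      using c Cay_ball_step(2)[OF c(1) _ c(2)] Suc.prems q tS by (auto simp: adjD M.m_assoc)
    then show ?case using Suc.IH[OF c(1)] Suc.prems by auto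
  qed
  have pull: "(q, x) \<in> adjacency D ^^ k \<Longrightarrow> k \<le> n \<Longrightarrow> \<exists>b. (\<one>\<^bsub>K\<^esub>, b) \<in> ?A ^^ k \<and> x = ?f b" for x k
  proof (induction k arbitrary: x)
    case 0
    then show ?case using q t_one by auto
  next
    case (Suc k)
    then obtain y s where y: "(q, y) \<in> adjacency D ^^ k" "s \<in> S" "x = y \<otimes>\<^bsub>M\<^esub> t s"
      by (metis adjD relpow_Suc_E)
    then obtain c where c: "(\<one>\<^bsub>K\<^esub>, c) \<in> ?A ^^ k" "y = ?f c" using Suc by auto
    have "t c \<in> carrier M" using Cay_ball_in_B[OF c(1)] Suc.prems t_closed by simp
    then have "x = ?f (c \<otimes>\<^bsub>K\<^esub> s)"
      using y c Cay_ball_step(2)[OF c(1) _ y(2)] Suc.prems q tS by (auto simp: M.m_assoc)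
    then show ?case using Cay_ball_step(3)[OF c(1) _ y(2)] Suc.prems by auto
  qed
  have ballE: "\<exists>k\<le>n. (\<one>\<^bsub>K\<^esub>, b) \<in> ?A ^^ k" if "b \<in> ball_at (Cay K S) n \<one>\<^bsub>K\<^esub>" for b
    using that by (simp add: mem_ball_at)
  have ball_B: "b \<in> B" if "b \<in> ball_at (Cay K S) n \<one>\<^bsub>K\<^esub>" for b
    using ballE[OF that] Cay_ball_in_B by fastforce
  have inj: "b = c" if "?f b = ?f c" "b \<in> B" "c \<in> B" for b c
    using that q t_closed t_inj by (simp add: inj_on_def)
  have "bij_betw ?f (ball_at (Cay K S) n \<one>\<^bsub>K\<^esub>) (ball_at D n q)"
    unfolding bij_betw_def
  proof
    show "inj_on ?f (ball_at (Cay K S) n \<one>\<^bsub>K\<^esub>)"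
      using inj ball_B by (simp add: inj_on_def)
    show "?f ` ball_at (Cay K S) n \<one>\<^bsub>K\<^esub> = ball_at D n q"
    proof
      show "?f ` ball_at (Cay K S) n \<one>\<^bsub>K\<^esub> \<subseteq> ball_at D n q"
        using forth ballE ball_B t_closed q by (fastforce simp: mem_ball_at[of _ D] V)
      show "ball_at D n q \<subseteq> ?f ` ball_at (Cay K S) n \<one>\<^bsub>K\<^esub>"
      proof
        fix x assume "x \<in> ball_at D n q"
        then obtain k where k: "k \<le> n" "(q, x) \<in> adjacency D ^^ k" by (auto simp: mem_ball_at)
        then obtain b where b: "(\<one>\<^bsub>K\<^esub>, b) \<in> ?A ^^ k" "x = ?f b" using pull by blast
        have "b \<in> carrier K" using Cay_ball_words[OF b(1)] S_closed by auto
        then have "b \<in> ball_at (Cay K S) n \<one>\<^bsub>K\<^esub>" using b(1) k(1) by (auto simp: mem_ball_at)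
        then show "x \<in> ?f ` ball_at (Cay K S) n \<one>\<^bsub>K\<^esub>" using b(2) by blast
      qed
    qed
  qed
  moreover have "?f \<one>\<^bsub>K\<^esub> = q" using q t_one by simp
  moreover have "(b, s, c) \<in> edges (neighbourhood (Cay K S) n \<one>\<^bsub>K\<^esub>) \<longleftrightarrow>
      (?f b, s, ?f c) \<in> edges (neighbourhood D n q)"
    if b: "b \<in> ball_at (Cay K S) n \<one>\<^bsub>K\<^esub>" and c: "c \<in> ball_at (Cay K S) n \<one>\<^bsub>K\<^esub>" for b s c
  proof -
    have img: "?f b \<in> ball_at D n q" "?f c \<in> ball_at D n q"
      using calculation(1) b c by (auto simp: bij_betw_def)
    have carr: "b \<in> carrier K" "t b \<in> carrier M" "?f b \<in> carrier M"
      using b ball_B t_closed q by (auto simp: mem_ball_at)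
    have "c = b \<otimes>\<^bsub>K\<^esub> s \<longleftrightarrow> ?f c = ?f b \<otimes>\<^bsub>M\<^esub> t s" if s: "s \<in> S"
    proof -
      obtain k where k: "k \<le> n" "(\<one>\<^bsub>K\<^esub>, b) \<in> ?A ^^ k" using ballE[OF b] by blast
      have "?f b \<otimes>\<^bsub>M\<^esub> t s = ?f (b \<otimes>\<^bsub>K\<^esub> s)"
        using Cay_ball_step(2)[OF k(2,1) s] carr q tS[OF s] by (simp add: M.m_assoc)
      then show ?thesis using inj ball_B[OF c] Cay_ball_step(1)[OF k(2,1) s] by metis
    qed
    then show ?thesis
      using b c img carr by (auto simp: edges_neighbourhood edges_Cay E)
  qed
  ultimately have "rooted_iso_map ?f (neighbourhood (Cay K S) n \<one>\<^bsub>K\<^esub>) \<one>\<^bsub>K\<^esub> (neighbourhood D n q) q"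
    unfolding rooted_iso_map_def by blast
  moreover have "\<one>\<^bsub>K\<^esub> \<in> ball_at (Cay K S) n \<one>\<^bsub>K\<^esub>"
    by (rule root_in_ball_at) simp
  ultimately show ?thesis
    unfolding rooted_isomorphic_iff by (meson rooted_iso_map_inverse)
qed

lemma t_generate: "b \<in> B \<Longrightarrow> t b \<in> generate M (t ` S)"
proof -
  have "set ws \<subseteq> S \<Longrightarrow> length ws \<le> Suc n \<Longrightarrow> t (list_prod K ws) \<in> generate M (t ` S)" for ws
  proof (induction ws)
    case Nil
    then show ?case by (simp add: t_one generate.one)
  next
    case (Cons s ws)
    then have "t (list_prod K (s # ws)) = t s \<otimes>\<^bsub>M\<^esub> t (list_prod K ws)"
      using t_mult[OF S_subset_B B_I[of ws]] B_I[of "s # ws"] by auto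
    then show ?case using Cons by (auto intro: generate.eng generate.incl)
  qed
  then show "b \<in> B \<Longrightarrow> t b \<in> generate M (t ` S)" by (auto simp: B_def)
qed

text \<open>
  Soficity of the subgroup \<open>M'\<close> generated by \<open>t ` S\<close> gives approximations for some generating set
  \<open>S0\<close> only. Choosing for every \<open>s \<in> S\<close> a word \<open>w s\<close> over \<open>S0\<close> that spells \<open>t s\<close>, the graph of walks
  of an approximation of \<open>Cay(M', S0)\<close> approximates the Cayley graph of \<open>M'\<close> with edges labelled by
  \<open>S\<close>, which looks like \<open>Cay(K, S)\<close> on \<open>n\<close>-balls.
\<close>

theorem sofic_imp_approximation:
  assumes "sofic M" and "finite S" and "1 < n"
  shows "\<exists>\<Gamma> :: (nat, 'a) labelled_digraph.
    finite (vertices \<Gamma>) \<and> graph_labelled_by S \<Gamma> \<and> approximates_Cay n \<Gamma> K S"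
proof -
  define M' where "M' = subgroup_generated M (t ` S)"
  have tS: "t ` S \<subseteq> carrier M" using t_closed S_subset_B by blast
  interpret M': group M' unfolding M'_def by simp
  have M'_simps: "mult M' = mult M" "one M' = one M" and M'_carrier: "carrier M' = generate M (t ` S)"
    unfolding M'_def using tS by (auto simp: carrier_subgroup_generated Int_absorb1)
  have "fg_sofic M'"
    unfolding M'_def using assms tS by (auto simp: sofic_def)
  then obtain S0 where S0: "finite_symmetric_generating_set M' S0"
    and approx: "\<And>N. 1 < N \<Longrightarrow> \<exists>\<Gamma> :: (nat, 'b) labelled_digraph.
          finite (vertices \<Gamma>) \<and> graph_labelled_by S0 \<Gamma> \<and> approximates_Cay N \<Gamma> M' S0"
    by (auto simp: fg_sofic_def)
  have S0_closed: "S0 \<subseteq> carrier M'" and gen: "generate M' S0 = carrier M'"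
    and S0_inv: "\<And>s. s \<in> S0 \<Longrightarrow> inv\<^bsub>M'\<^esub> s \<in> S0"
    using S0 by (auto simp: finite_symmetric_generating_set_def)
  have "\<exists>ws. set ws \<subseteq> S0 \<and> list_prod M' ws = t s" if "s \<in> S" for s
    using M'.generate_imp_list_prod[OF S0_closed S0_inv] gen that t_generate S_subset_B M'_carrier
    by blast
  then obtain w where w: "\<And>s. s \<in> S \<Longrightarrow> set (w s) \<subseteq> S0 \<and> list_prod M' (w s) = t s"
    by metis
  define m where "m = Max (insert 0 ((\<lambda>s. length (w s)) ` S))"
  have m: "length (w s) \<le> m" if "s \<in> S" for s
    unfolding m_def using assms(2) that by (auto intro: Max_ge)
  \<comment> \<open>The summand \<open>n\<close> makes the exceptional proportion \<open>1/N\<close> at most \<open>1/n\<close>, and \<open>Suc n * m\<close> is the radius that the graph of walks requires.\<close>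
  define N where "N = n + Suc n * m"
  have N: "1 < N" "n \<le> N" "Suc n * m \<le> N" using assms(3) by (auto simp: N_def)
  obtain \<Gamma> :: "(nat, 'b) labelled_digraph" where fin: "finite (vertices \<Gamma>)"
    and lab: "graph_labelled_by S0 \<Gamma>" and app: "approximates_Cay N \<Gamma> M' S0"
    using approx[OF N(1)] by blast
  obtain W where W: "W \<subseteq> vertices \<Gamma>"
      "real (card W) > (1 - 1 / real N) * real (card (vertices \<Gamma>))"
    and iso: "\<And>p. p \<in> W \<Longrightarrow> \<exists>q\<in>carrier M'.
        rooted_isomorphic (neighbourhood \<Gamma> N p) p (neighbourhood (Cay M' S0) N q) q"
    using app by (auto simp: approximates_Cay_def)
  define D where "D = walk_graph S w (Cay M' S0)"
  have E: "(u, s, v) \<in> edges D \<longleftrightarrow> u \<in> carrier M' \<and> s \<in> S \<and> v = u \<otimes>\<^bsub>M'\<^esub> t s" for u s v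
  proof (cases "s \<in> S \<and> u \<in> carrier M'")
    case True
    then have "t s \<in> carrier M'" using t_generate S_subset_B M'_carrier by blast
    then show ?thesis
      using True w[of s] M'.walk_Cay[OF S0_closed, of "w s" u v]
      by (auto simp: D_def edges_walk_graph)
  qed (auto simp: D_def edges_walk_graph)
  interpret K_M': cayley_ball_embedding K M' S n t B
    using S_closed S_inv t_generate t_inj t_mult
    by unfold_locales (auto simp: M'_simps M'_carrier B_def)
  have "rooted_isomorphic (neighbourhood (walk_graph S w \<Gamma>) n p) p
      (neighbourhood (Cay K S) n \<one>\<^bsub>K\<^esub>) \<one>\<^bsub>K\<^esub>" if "p \<in> W" for p
  proof -
    obtain q where q: "q \<in> carrier M'"
      "rooted_isomorphic (neighbourhood \<Gamma> N p) p (neighbourhood (Cay M' S0) N q) q"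
      using iso[OF \<open>p \<in> W\<close>] by blast
    have "rooted_isomorphic (neighbourhood (walk_graph S w \<Gamma>) n p) p (neighbourhood D n q) q"
      unfolding D_def
      by (rule walk_graph_rooted_isomorphic[OF q(2) lab M'.graph_labelled_by_Cay[OF S0_closed] _ _ m N(3)])
        (use that W q in auto)
    moreover have "rooted_isomorphic (neighbourhood D n q) q (neighbourhood (Cay K S) n \<one>\<^bsub>K\<^esub>) \<one>\<^bsub>K\<^esub>"
      by (rule K_M'.Cay_ball_iso[OF _ E q(1)]) (simp add: D_def)
    ultimately show ?thesis
      unfolding rooted_isomorphic_iff using rooted_iso_map_trans by metis
  qed
  moreover have "(1 - 1 / real n) * real (card (vertices \<Gamma>)) \<le> (1 - 1 / real N) * real (card (vertices \<Gamma>))"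
    using N assms(3) by (intro mult_right_mono) (auto simp: frac_le)
  ultimately have "approximates_Cay n (walk_graph S w \<Gamma>) K S"
    unfolding approximates_Cay_def using W by (intro exI[of _ W]) fastforce
  moreover have "graph_labelled_by S (walk_graph S w \<Gamma>)"
    by (auto simp: graph_labelled_by_def edges_walk_graph)
  ultimately show ?thesis using fin by (intro exI[of _ "walk_graph S w \<Gamma>"]) auto
qed

end

definition partial_embedding ::
    "('a, 'm) monoid_scheme \<Rightarrow> ('b, 'n) monoid_scheme \<Rightarrow> 'a set \<Rightarrow> ('a \<Rightarrow> 'b) \<Rightarrow> bool" where
  "partial_embedding K M B t \<longleftrightarrow> t ` B \<subseteq> carrier M \<and> inj_on t B \<and>
     (\<forall>x\<in>B. \<forall>y\<in>B. x \<otimes>\<^bsub>K\<^esub> y \<in> B \<longrightarrow> t (x \<otimes>\<^bsub>K\<^esub> y) = t x \<otimes>\<^bsub>M\<^esub> t y)"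

lemma (in group) symmetrized_generating_set:
  assumes "finite T" and "T \<subseteq> carrier G"
  shows "finite_symmetric_generating_set (subgroup_generated G T) (T \<union> m_inv G ` T)"
proof -
  let ?H = "subgroup_generated G T"
  interpret H: group ?H by simp
  have T: "T \<subseteq> carrier ?H"
    using assms(2) by (auto simp: carrier_subgroup_generated generate.incl)
  have inv: "inv\<^bsub>?H\<^esub> x = inv x" if "x \<in> carrier ?H" for x
    using that by (rule inv_subgroup_generated)
  have closed: "T \<union> m_inv G ` T \<subseteq> carrier ?H"
  proof -
    have "inv x \<in> carrier ?H" if "x \<in> T" for x
      using H.inv_closed[of x] inv[of x] T that by auto
    then show ?thesis using T by auto
  qed
  have "generate ?H (T \<union> m_inv G ` T) = carrier ?H"
  proof
    show "generate ?H (T \<union> m_inv G ` T) \<subseteq> carrier ?H" using H.generate_incl[OF closed] .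
    have "carrier ?H = generate ?H (carrier ?H \<inter> T)"
      using carrier_subgroup_generated[of ?H T] subgroup_generated2[of T] by simp
    also have "\<dots> \<subseteq> generate ?H (T \<union> m_inv G ` T)" by (rule H.mono_generate) auto
    finally show "carrier ?H \<subseteq> generate ?H (T \<union> m_inv G ` T)" .
  qed
  moreover have "\<forall>s\<in>T \<union> m_inv G ` T. inv\<^bsub>?H\<^esub> s \<in> T \<union> m_inv G ` T"
    using closed inv assms(2) by (auto simp: subset_iff)
  ultimately show ?thesis
    using closed assms(1) by (simp add: finite_symmetric_generating_set_def)
qed

text \<open>
  The finite set consists of the short words over a symmetric generating set of a nonsofic finitely
  generated subgroup \<open>H\<close>, where \<open>n\<close> is such that \<open>Cay(H, S)\<close> has no \<open>n\<close>-approximation. If such a set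
  embedded partially in a sofic group, \<open>sofic_imp_approximation\<close> would produce one.
\<close>

theorem (in group) nonsofic_finite_obstruction:
  assumes "\<not> sofic G"
  shows "\<exists>B. finite B \<and> B \<subseteq> carrier G \<and>
    (\<forall>(M :: ('c, 'n) monoid_scheme) t. group M \<longrightarrow> partial_embedding G M B t \<longrightarrow> \<not> sofic M)"
proof -
  obtain T where T: "finite T" "T \<subseteq> carrier G" "\<not> fg_sofic (subgroup_generated G T)"
    using assms by (auto simp: sofic_def)
  define H where "H = subgroup_generated G T"
  define S where "S = T \<union> m_inv G ` T"
  interpret H: group H by (simp add: H_def)
  have S: "finite_symmetric_generating_set H S"
    unfolding H_def S_def by (rule symmetrized_generating_set[OF T(1,2)])
  then have S': "finite S" "S \<subseteq> carrier H" "\<And>s. s \<in> S \<Longrightarrow> inv\<^bsub>H\<^esub> s \<in> S"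
    by (auto simp: finite_symmetric_generating_set_def)
  obtain n where n: "1 < n" and no_approx: "\<And>\<Gamma> :: (nat, 'a) labelled_digraph.
      \<not> (finite (vertices \<Gamma>) \<and> graph_labelled_by S \<Gamma> \<and> approximates_Cay n \<Gamma> H S)"
    using T(3) S unfolding fg_sofic_def H_def by metis
  define B where "B = list_prod H ` {ws. set ws \<subseteq> S \<and> length ws \<le> Suc n}"
  have "finite B" unfolding B_def using finite_lists_length_le[OF S'(1)] by (rule finite_imageI)
  moreover have "B \<subseteq> carrier H"
    unfolding B_def using S'(2) by (auto intro!: H.list_prod_closed)
  then have "B \<subseteq> carrier G"
    using carrier_subgroup_generated_subset[of T] by (auto simp: H_def)
  moreover have "\<not> sofic M" if M: "group M" and t: "partial_embedding G M B t"
    for M :: "('c, 'n) monoid_scheme" and t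
  proof
    assume "sofic M"
    interpret M: group M by (rule M)
    have t': "\<And>x. x \<in> B \<Longrightarrow> t x \<in> carrier M" "inj_on t B"
        "\<And>x y. x \<in> B \<Longrightarrow> y \<in> B \<Longrightarrow> x \<otimes>\<^bsub>H\<^esub> y \<in> B \<Longrightarrow> t (x \<otimes>\<^bsub>H\<^esub> y) = t x \<otimes>\<^bsub>M\<^esub> t y"
      using t by (auto simp: partial_embedding_def H_def)
    interpret cayley_ball_embedding H M S n t B
      using S' t' by unfold_locales (simp_all add: B_def)
    show False using sofic_imp_approximation[OF \<open>sofic M\<close> S'(1) n] no_approx by blast
  qed
  ultimately show ?thesis by blast
qed


section \<open>Subdirect products\<close>

lemma unique_product_iff:
  "unique_product G \<longleftrightarrow>
     (\<forall>X Y. finite X \<longrightarrow> X \<noteq> {} \<longrightarrow> X \<subseteq> carrier G \<longrightarrow> finite Y \<longrightarrow> Y \<noteq> {} \<longrightarrow> Y \<subseteq> carrier G \<longrightarrow>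
       (\<exists>a\<in>X. \<exists>b\<in>Y. \<forall>x\<in>X. \<forall>y\<in>Y. x \<otimes>\<^bsub>G\<^esub> y = a \<otimes>\<^bsub>G\<^esub> b \<longrightarrow> x = a \<and> y = b))"
proof -
  have "(\<exists>g. \<exists>!z. z \<in> X \<times> Y \<and> fst z \<otimes>\<^bsub>G\<^esub> snd z = g) \<longleftrightarrow>
      (\<exists>a\<in>X. \<exists>b\<in>Y. \<forall>x\<in>X. \<forall>y\<in>Y. x \<otimes>\<^bsub>G\<^esub> y = a \<otimes>\<^bsub>G\<^esub> b \<longrightarrow> x = a \<and> y = b)" for X Y
    by (auto simp: Ex1_def) blast
  then show ?thesis by (simp add: unique_product_def)
qed

text \<open>
  The group \<open>M\<close> is described through its projections, so that no enumeration of the product has to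
  be fixed and properties need not be transported along isomorphisms.
\<close>

locale subdirect_product = M: group M + G: group G + K: group K
  for M :: "('c, 'k) monoid_scheme" and G :: "('a, 'm) monoid_scheme" and K :: "('b, 'n) monoid_scheme" +
  fixes p :: "'c \<Rightarrow> 'a" and q :: "'c \<Rightarrow> 'b"
  assumes p_hom: "p \<in> hom M G" and q_hom: "q \<in> hom M K"
    and pq_inj: "inj_on (\<lambda>x. (p x, q x)) (carrier M)"
begin

sublocale p: group_hom M G p by unfold_locales (rule p_hom)
sublocale q: group_hom M K q by unfold_locales (rule q_hom)

lemma pq_eqI: "x \<in> carrier M \<Longrightarrow> y \<in> carrier M \<Longrightarrow> p x = p y \<Longrightarrow> q x = q y \<Longrightarrow> x = y"
  using pq_inj by (auto simp: inj_on_def)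

lemma pq_oneI: "x \<in> carrier M \<Longrightarrow> p x = \<one>\<^bsub>G\<^esub> \<Longrightarrow> q x = \<one>\<^bsub>K\<^esub> \<Longrightarrow> x = \<one>\<^bsub>M\<^esub>"
  by (rule pq_eqI) auto

lemma torsion_free_subdirect:
  assumes "torsion_free G" and "torsion_free K"
  shows "torsion_free M"
  unfolding torsion_free_def
proof (intro ballI allI impI)
  fix x and n :: nat
  assume x: "x \<in> carrier M" and n: "0 < n" "x [^]\<^bsub>M\<^esub> n = \<one>\<^bsub>M\<^esub>"
  have "p x [^]\<^bsub>G\<^esub> n = \<one>\<^bsub>G\<^esub>" "q x [^]\<^bsub>K\<^esub> n = \<one>\<^bsub>K\<^esub>"
    using n x p.hom_nat_pow[of x n] q.hom_nat_pow[of x n] by simp_all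
  then show "x = \<one>\<^bsub>M\<^esub>"
    using assms x n(1) by (intro pq_oneI) (auto simp: torsion_free_def)
qed

text \<open>
  The lexicographic order: invariance is inherited because the projections are homomorphisms and
  multiplication by a fixed element is injective in \<open>G\<close>.
\<close>

definition lex_rel :: "'a rel \<Rightarrow> 'b rel \<Rightarrow> 'c rel" where
  "lex_rel r s = {(x, y) \<in> carrier M \<times> carrier M.
     (p x, p y) \<in> r \<and> p x \<noteq> p y \<or> p x = p y \<and> (q x, q y) \<in> s}"

lemma linear_order_on_lex_rel:
  assumes r: "linear_order_on (carrier G) r" and s: "linear_order_on (carrier K) s"
  shows "linear_order_on (carrier M) (lex_rel r s)"
proof -
  have rs: "trans r" "antisym r" "total_on (carrier G) r" 
      "trans s" "antisym s" "total_on (carrier K) s" "refl_on (carrier K) s"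
    using r s by (auto simp: order_on_defs)
  have "refl_on (carrier M) (lex_rel r s)"
    using rs(7) by (auto simp: refl_on_def lex_rel_def)
  moreover have "trans (lex_rel r s)"
    unfolding lex_rel_def trans_def using rs(1,2,4)
    by (clarsimp simp: trans_def antisym_def) metis
  moreover have "antisym (lex_rel r s)"
    unfolding lex_rel_def using rs(2,5) by (auto simp: antisym_def intro: pq_eqI)
  moreover have "total_on (carrier M) (lex_rel r s)"
    unfolding total_on_def
  proof (intro ballI impI)
    fix x y assume xy: "x \<in> carrier M" "y \<in> carrier M" "x \<noteq> y"
    show "(x, y) \<in> lex_rel r s \<or> (y, x) \<in> lex_rel r s"
    proof (cases "p x = p y")
      case True
      then have "q x \<noteq> q y" using pq_eqI xy by blast
      then show ?thesis using rs(6) xy True by (auto simp: lex_rel_def total_on_def)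
    next
      case False
      then show ?thesis using rs(3) xy by (auto simp: lex_rel_def total_on_def)
    qed
  qed
  ultimately show ?thesis
    by (auto simp: order_on_defs lex_rel_def)
qed

lemma left_invariant_lex_rel:
  assumes "left_invariant_rel G r" and "left_invariant_rel K s"
  shows "left_invariant_rel M (lex_rel r s)"
  using assms by (auto simp: left_invariant_rel_def lex_rel_def)

lemma right_invariant_lex_rel:
  assumes "right_invariant_rel G r" and "right_invariant_rel K s"
  shows "right_invariant_rel M (lex_rel r s)"
  using assms by (auto simp: right_invariant_rel_def lex_rel_def)

lemma left_orderable_subdirect:
  assumes "left_orderable G" and "left_orderable K"
  shows "left_orderable M"
  using assms linear_order_on_lex_rel left_invariant_lex_rel unfolding left_orderable_def by meson

lemma biorderable_subdirect:
  assumes "biorderable G" and "biorderable K"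
  shows "biorderable M"
  using assms linear_order_on_lex_rel left_invariant_lex_rel right_invariant_lex_rel
  unfolding biorderable_def by meson

text \<open>
  A uniquely represented product \<open>a b\<close> of the first projections leaves only the fibres of \<open>X\<close> over
  \<open>a\<close> and of \<open>Y\<close> over \<open>b\<close>; a unique product of the second projections of these two fibres singles
  out one pair.
\<close>

lemma unique_product_subdirect:
  assumes G: "unique_product G" and K: "unique_product K"
  shows "unique_product M"
  unfolding unique_product_iff
proof (intro allI impI)
  fix X Y
  assume X: "finite X" "X \<noteq> {}" "X \<subseteq> carrier M" and Y: "finite Y" "Y \<noteq> {}" "Y \<subseteq> carrier M"
  have "p ` X \<subseteq> carrier G" "p ` Y \<subseteq> carrier G" using X Y by auto
  then have "\<exists>a\<in>p ` X. \<exists>b\<in>p ` Y. \<forall>a'\<in>p ` X. \<forall>b'\<in>p ` Y.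
      a' \<otimes>\<^bsub>G\<^esub> b' = a \<otimes>\<^bsub>G\<^esub> b \<longrightarrow> a' = a \<and> b' = b"
    by (intro G[unfolded unique_product_iff, rule_format]) (use X Y in simp_all)
  then obtain a b where ab: "a \<in> p ` X" "b \<in> p ` Y"
    and ab_unique: "\<forall>a'\<in>p ` X. \<forall>b'\<in>p ` Y. a' \<otimes>\<^bsub>G\<^esub> b' = a \<otimes>\<^bsub>G\<^esub> b \<longrightarrow> a' = a \<and> b' = b"
    by (elim bexE)
  define X' Y' where "X' = {x \<in> X. p x = a}" and "Y' = {y \<in> Y. p y = b}"
  have "q ` X' \<subseteq> carrier K" "q ` Y' \<subseteq> carrier K" "finite (q ` X')" "finite (q ` Y')"
      "q ` X' \<noteq> {}" "q ` Y' \<noteq> {}"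
    using X Y ab by (auto simp: X'_def Y'_def)
  then have "\<exists>c\<in>q ` X'. \<exists>d\<in>q ` Y'. \<forall>c'\<in>q ` X'. \<forall>d'\<in>q ` Y'.
      c' \<otimes>\<^bsub>K\<^esub> d' = c \<otimes>\<^bsub>K\<^esub> d \<longrightarrow> c' = c \<and> d' = d"
    by (intro K[unfolded unique_product_iff, rule_format]) simp_all
  then obtain c d where cd: "c \<in> q ` X'" "d \<in> q ` Y'"
    and cd_unique: "\<forall>c'\<in>q ` X'. \<forall>d'\<in>q ` Y'. c' \<otimes>\<^bsub>K\<^esub> d' = c \<otimes>\<^bsub>K\<^esub> d \<longrightarrow> c' = c \<and> d' = d"
    by (elim bexE)
  obtain x y where xy: "x \<in> X'" "q x = c" "y \<in> Y'" "q y = d" using cd by auto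
  then have xy': "x \<in> X" "p x = a" "y \<in> Y" "p y = b" by (auto simp: X'_def Y'_def)
  have "x' = x \<and> y' = y" if "x' \<in> X" "y' \<in> Y" "x' \<otimes>\<^bsub>M\<^esub> y' = x \<otimes>\<^bsub>M\<^esub> y" for x' y'
  proof -
    have carr: "x' \<in> carrier M" "y' \<in> carrier M" "x \<in> carrier M" "y \<in> carrier M"
      using that xy' X Y by auto
    then have eq: "p x' \<otimes>\<^bsub>G\<^esub> p y' = a \<otimes>\<^bsub>G\<^esub> b" "q x' \<otimes>\<^bsub>K\<^esub> q y' = c \<otimes>\<^bsub>K\<^esub> d"
      using that(3) xy xy' by (metis p.hom_mult, metis q.hom_mult)
    then have p_eq: "p x' = a" "p y' = b" using bspec[OF bspec[OF ab_unique], of "p x'" "p y'"] that by simp_all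
    then have "x' \<in> X'" "y' \<in> Y'" using that by (simp_all add: X'_def Y'_def)
    then have "q x' = c" "q y' = d"
      using bspec[OF bspec[OF cd_unique], of "q x'" "q y'"] eq(2) by simp_all
    then show ?thesis using pq_eqI carr p_eq xy xy' by metis
  qed
  then show "\<exists>a\<in>X. \<exists>b\<in>Y. \<forall>x\<in>X. \<forall>y\<in>Y. x \<otimes>\<^bsub>M\<^esub> y = a \<otimes>\<^bsub>M\<^esub> b \<longrightarrow> x = a \<and> y = b"
    using xy' by blast
qed

end

lemma hom_compose_onto:
  assumes "f \<in> hom G H" and "f ` carrier G = carrier H"
    and "g \<in> hom H I" and "g ` carrier H = carrier I"
  shows "g \<circ> f \<in> hom G I" and "(g \<circ> f) ` carrier G = carrier I"
  using assms(2,4) hom_compose[OF assms(1,3)] by (simp_all only: image_comp[symmetric])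

lemma (in group) infinite_cyclic_quotient_iff:
  "(\<exists>N. N \<lhd> G \<and> G Mod N \<cong> integer_group) \<longleftrightarrow> (\<exists>h \<in> hom G integer_group. h ` carrier G = carrier integer_group)"
    (is "?L \<longleftrightarrow> ?R")
proof
  assume ?L
  then obtain N f where N: "N \<lhd> G" and f: "f \<in> iso (G Mod N) integer_group"
    by (auto simp: is_iso_def)
  have "(\<lambda>a. N #> a) \<in> hom G (G Mod N)" by (rule normal.r_coset_hom_Mod[OF N])
  moreover have "(\<lambda>a. N #> a) ` carrier G = carrier (G Mod N)"
    by (auto simp: FactGroup_def RCOSETS_def)
  moreover have "f \<in> hom (G Mod N) integer_group" "f ` carrier (G Mod N) = carrier integer_group"
    using f by (auto simp: iso_def bij_betw_def)
  ultimately show ?R using hom_compose_onto[of "\<lambda>a. N #> a" G "G Mod N" f integer_group] by blast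
next
  assume ?R
  then obtain h where h: "h \<in> hom G integer_group" "h ` carrier G = carrier integer_group" by blast
  interpret h: group_hom G integer_group h
    using h(1) by (simp add: group_hom_def group_hom_axioms_def is_group)
  show ?L using h.normal_kernel h.FactGroup_iso[OF h(2)] by blast
qed

text \<open>
  If \<open>h\<close> does not kill \<open>T\<close>, then the image of the subgroup generated by \<open>T\<close> is a nontrivial finitely
  generated subgroup of \<open>H\<close>, and its infinite cyclic quotient is one of the subgroup generated by
  \<open>T\<close>. A nontrivial element of a subdirect product is not killed by both projections, so this
  settles local indicability.
\<close>

lemma (in group_hom) pullback_infinite_cyclic_quotient:
  assumes H: "locally_indicable H" and T: "finite T" "T \<subseteq> carrier G" and x: "x \<in> T" "h x \<noteq> \<one>\<^bsub>H\<^esub>"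
  shows "\<exists>N. N \<lhd> subgroup_generated G T \<and> subgroup_generated G T Mod N \<cong> integer_group"
proof -
  have hT: "h ` T \<subseteq> carrier H" using T by auto
  then have "\<not> trivial_group (subgroup_generated H (h ` T))"
    using x by (auto simp: H.trivial_group_subgroup_generated_eq)
  then obtain f where f: "f \<in> hom (subgroup_generated H (h ` T)) integer_group"
      "f ` carrier (subgroup_generated H (h ` T)) = carrier integer_group"
    using H[unfolded locally_indicable_def, rule_format, of "h ` T"] hT T(1)
    unfolding group.infinite_cyclic_quotient_iff[OF H.group_subgroup_generated] by blast
  have "h \<in> hom (subgroup_generated G T) (subgroup_generated H (h ` T))"
    using hom_between_subgroups[of T "h ` T"] by simp
  moreover have "h ` carrier (subgroup_generated G T) = carrier (subgroup_generated H (h ` T))"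
    using subgroup_generated_by_image[OF T(2)] by simp
  ultimately have "\<exists>g \<in> hom (subgroup_generated G T) integer_group.
      g ` carrier (subgroup_generated G T) = carrier integer_group"
    using f by (metis hom_compose_onto)
  then show ?thesis
    unfolding group.infinite_cyclic_quotient_iff[OF G.group_subgroup_generated] .
qed

lemma (in subdirect_product) locally_indicable_subdirect:
  assumes "locally_indicable G" and "locally_indicable K"
  shows "locally_indicable M"
  unfolding locally_indicable_def
proof (intro allI impI)
  fix T assume T: "finite T" "T \<subseteq> carrier M" and "\<not> trivial_group (subgroup_generated M T)"
  then obtain x where "x \<in> T" "x \<noteq> \<one>\<^bsub>M\<^esub>"
    by (auto simp: M.trivial_group_subgroup_generated_eq)
  then have "p x \<noteq> \<one>\<^bsub>G\<^esub> \<or> q x \<noteq> \<one>\<^bsub>K\<^esub>" using pq_oneI T by blast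
  then show "\<exists>N. N \<lhd> subgroup_generated M T \<and> subgroup_generated M T Mod N \<cong> integer_group"
    using p.pullback_infinite_cyclic_quotient[OF assms(1) T \<open>x \<in> T\<close>]
      q.pullback_infinite_cyclic_quotient[OF assms(2) T \<open>x \<in> T\<close>]
    by (rule disjE)
qed

section \<open>Free subgroups of subdirect products\<close>

lemma freely_reduced_conjugate:
  assumes "freely_reduced u" and "u \<noteq> []" and "c \<noteq> inv_letter (hd u)" and "c \<noteq> last u"
  shows "freely_reduced (c # u @ [inv_letter c])"
proof -
  have "inv_letter c \<noteq> inv_letter (last u)" and "hd u \<noteq> inv_letter c"
    using assms(3,4) by (auto simp: inv_letter_def prod_eq_iff)
  then show ?thesis
    using assms(1,2) by (auto simp: freely_reduced_def successively_append_iff successively_Cons)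
qed

lemma foldr_cancel_cons_reduced:
  "freely_reduced (u @ v) \<Longrightarrow> foldr cancel_cons u v = u @ v"
proof (induction u)
  case (Cons k u)
  then have "freely_reduced (u @ v)" and "u @ v \<noteq> [] \<Longrightarrow> hd (u @ v) \<noteq> inv_letter k"
    by (auto simp: freely_reduced_def successively_Cons)
  then show ?case using Cons.IH by (cases "u @ v") auto
qed simp

text \<open>
  Conjugating a reduced word \<open>u\<close> by a letter \<open>c\<close> involves no cancellation unless \<open>c\<close> is the inverse of
  the first letter or equal to the last letter of \<open>u\<close>. Two conjugations, the first one by a suitable
  intermediate letter \<open>c\<close>, bring \<open>(x, True)\<close> to the front and its inverse to the end.
\<close>

lemma conjugation_closed_contains_bracketed_word:
  assumes N: "N \<subseteq> carrier (free_group X)"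
    and conj: "\<And>u c. u \<in> N \<Longrightarrow> fst c \<in> X \<Longrightarrow>
      [c] \<otimes>\<^bsub>free_group X\<^esub> (u \<otimes>\<^bsub>free_group X\<^esub> [inv_letter c]) \<in> N"
    and x: "x \<in> X" and y: "y \<in> X" "x \<noteq> y"
    and u: "u \<in> N" "u \<noteq> []"
  shows "\<exists>v. (x, True) # v @ [(x, False)] \<in> N"
proof -
  have step: "c # w @ [inv_letter c] \<in> N"
    if "w \<in> N" "w \<noteq> []" "fst c \<in> X" "c \<noteq> inv_letter (hd w)" "c \<noteq> last w" for w c
  proof -
    have "freely_reduced w" using that(1) N by (auto simp: free_group_def)
    then have red: "freely_reduced (c # w @ [inv_letter c])"
      using that by (intro freely_reduced_conjugate)
    then have "freely_reduced (w @ [inv_letter c])"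
      by (auto simp: freely_reduced_def successively_Cons)
    then have "[c] \<otimes>\<^bsub>free_group X\<^esub> (w \<otimes>\<^bsub>free_group X\<^esub> [inv_letter c]) = c # w @ [inv_letter c]"
      using foldr_cancel_cons_reduced[of "[c]" "w @ [inv_letter c]"] red
      by (simp add: free_group_def foldr_cancel_cons_reduced)
    then show ?thesis using conj[OF that(1,3)] by simp
  qed
  \<comment> \<open>Of these three letters at most two are excluded; the omitted letter \<open>(x, False)\<close> would cancel against \<open>(x, True)\<close> in the second conjugation.\<close>
  have "\<exists>c \<in> {(x, True), (y, True), (y, False)}. c \<noteq> inv_letter (hd u) \<and> c \<noteq> last u"
    using y(2) by (cases "inv_letter (hd u)"; cases "last u") auto
  then obtain c where c: "c \<in> {(x, True), (y, True), (y, False)}" "c \<noteq> inv_letter (hd u)" "c \<noteq> last u"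
    by blast
  have ne: "(x, True) \<noteq> inv_letter c"
    using c(1) y(2) by (elim insertE) (simp_all add: inv_letter_def)
  have "c # u @ [inv_letter c] \<in> N"
    by (rule step) (use u c x y in auto)
  then have "(x, True) # (c # u @ [inv_letter c]) @ [inv_letter (x, True)] \<in> N"
    by (rule step) (use ne x in auto)
  then show ?thesis
    unfolding inv_letter_def[of "(x, True)"] fst_conv snd_conv not_True_eq_False by (rule exI)
qed

text \<open>
  If \<open>H\<close> has no free subgroup of rank two, then a homomorphism to \<open>H\<close> is not injective on a free
  subgroup of rank two. The reduced words that represent elements of its kernel are closed under
  conjugation by letters.
\<close>

lemma (in group_hom) kernel_contains_bracketed_word:
  assumes H: "no_free_subgroup H" and S: "subgroup S G" and iso: "f \<in> iso (G\<lparr>carrier := S\<rparr>) F\<^sub>2"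
    and xy: "x \<in> {1, 2}" "y \<in> {1, 2}" "x \<noteq> y"
  shows "\<exists>s\<in>S. h s = \<one>\<^bsub>H\<^esub> \<and> (\<exists>v. f s = (x, True) # v @ [(x, False)])"
proof -
  let ?S = "G\<lparr>carrier := S\<rparr>"
  interpret S: group ?S by (rule subgroup.subgroup_is_group[OF S G.group_axioms])
  have S_sub: "S \<subseteq> carrier G" using S by (rule subgroup.subset)
  have bij: "bij_betw f S (carrier F\<^sub>2)" using iso by (simp add: iso_def)
  have mult: "f (a \<otimes> b) = f a \<otimes>\<^bsub>F\<^sub>2\<^esub> f b" if "a \<in> S" "b \<in> S" for a b
    using iso that by (auto simp: iso_def hom_def)
  have closed: "a \<otimes> b \<in> S" if "a \<in> S" "b \<in> S" for a b
    using S that by (rule subgroup.m_closed)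
  have f_one: "f \<one> = []"
  proof -
    have "[] \<in> f ` S"
      unfolding bij_betw_imp_surj_on[OF bij] by (simp add: free_group_def freely_reduced_def)
    then obtain e where e: "e \<in> S" "f e = []" by auto
    then have "f (e \<otimes> e) = f e" using mult by (simp add: free_group_def)
    then have "e \<otimes> e = e" using bij e closed by (auto simp: bij_betw_def inj_on_def)
    then have "e = \<one>" using e S_sub by (metis G.l_cancel_one subsetD)
    then show ?thesis using e by simp
  qed
  define N where "N = f ` {s \<in> S. h s = \<one>\<^bsub>H\<^esub>}"
  have "\<not> inj_on h S"
  proof
    assume inj: "inj_on h S"
    have "h \<in> iso ?S (H\<lparr>carrier := h ` S\<rparr>)"
      using inj S_sub by (auto simp: iso_def hom_def bij_betw_def subset_iff)
    then have "H\<lparr>carrier := h ` S\<rparr> \<cong> ?S" using S.iso_sym by (auto simp: is_iso_def)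
    moreover have "?S \<cong> F\<^sub>2" using iso by (auto simp: is_iso_def)
    ultimately have "H\<lparr>carrier := h ` S\<rparr> \<cong> F\<^sub>2" by (rule iso_trans)
    moreover have "subgroup (h ` S) H" using S by (rule subgroup_img_is_subgroup)
    ultimately show False using H by (auto simp: no_free_subgroup_def)
  qed
  then obtain a b where "a \<in> S" "b \<in> S" "h a = h b" "a \<noteq> b"
    by (auto simp: inj_on_def)
  then have "a \<otimes> inv b \<in> S" "h (a \<otimes> inv b) = \<one>\<^bsub>H\<^esub>" "a \<otimes> inv b \<noteq> \<one>"
    using S S_sub by (auto simp: subgroup.m_closed subgroup.m_inv_closed subset_iff G.inv_solve_right' )
  then obtain s where s: "s \<in> S" "h s = \<one>\<^bsub>H\<^esub>" "s \<noteq> \<one>" by blast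
  then have "f s \<noteq> []"
    using f_one bij subgroup.one_closed[OF S] by (auto simp: bij_betw_def inj_on_def)
  moreover have "f s \<in> N" using s by (auto simp: N_def)
  moreover have "N \<subseteq> carrier F\<^sub>2" using bij by (auto simp: N_def bij_betw_def)
  moreover have "[c] \<otimes>\<^bsub>F\<^sub>2\<^esub> (u \<otimes>\<^bsub>F\<^sub>2\<^esub> [inv_letter c]) \<in> N" if u: "u \<in> N" and c: "fst c \<in> {1, 2}" for u c
  proof -
    obtain r where r: "r \<in> S" "h r = \<one>\<^bsub>H\<^esub>" "u = f r" using u by (auto simp: N_def)
    have "[c] \<in> f ` S" "[inv_letter c] \<in> f ` S"
      unfolding bij_betw_imp_surj_on[OF bij]
      using c by (simp_all add: free_group_def freely_reduced_def inv_letter_def)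
    then obtain d d' where d: "d \<in> S" "f d = [c]" "d' \<in> S" "f d' = [inv_letter c]"
      by (metis imageE)
    have "f (d \<otimes> d') = f \<one>"
      using d mult f_one by (simp add: free_group_def)
    then have "d \<otimes> d' = \<one>"
      using bij closed d subgroup.one_closed[OF S] by (auto simp: bij_betw_def inj_on_def)
    moreover have carr: "d \<in> carrier G" "d' \<in> carrier G" "r \<in> carrier G" using d r S_sub by auto
    ultimately have "h (d \<otimes> (r \<otimes> d')) = \<one>\<^bsub>H\<^esub>"
      using r(2) by (metis G.m_closed H.l_one hom_closed hom_mult hom_one)
    moreover have "f (d \<otimes> (r \<otimes> d')) = [c] \<otimes>\<^bsub>F\<^sub>2\<^esub> (u \<otimes>\<^bsub>F\<^sub>2\<^esub> [inv_letter c])"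
      using d r mult closed by simp
    ultimately show ?thesis
      using closed d r by (metis (mono_tags, lifting) N_def image_eqI mem_Collect_eq)
  qed
  ultimately obtain v where "(x, True) # v @ [(x, False)] \<in> N"
    using conjugation_closed_contains_bracketed_word[of N "{1, 2}" x y "f s"] xy by blast
  then obtain s where "s \<in> S" "h s = \<one>\<^bsub>H\<^esub>" "f s = (x, True) # v @ [(x, False)]"
    unfolding N_def image_iff by auto
  then show ?thesis by blast
qed

text \<open>
  On a free subgroup of rank two both projections would have nontrivial kernels. Elements \<open>s\<close> and \<open>r\<close>
  of the two kernels commute, since their commutator is killed by both projections. For
  \<open>s = x \<dots> x\<inverse>\<close> and \<open>r = y \<dots> y\<inverse>\<close> the products \<open>s r\<close> and \<open>r s\<close> are reduced as written
  and begin with different letters.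
\<close>

lemma (in subdirect_product) no_free_subgroup_subdirect:
  assumes "no_free_subgroup G" and "no_free_subgroup K"
  shows "no_free_subgroup M"
proof (rule ccontr)
  assume "\<not> no_free_subgroup M"
  then obtain S f where S: "subgroup S M" and f: "f \<in> iso (M\<lparr>carrier := S\<rparr>) F\<^sub>2"
    by (auto simp: no_free_subgroup_def is_iso_def)
  obtain s v where s: "s \<in> S" "p s = \<one>\<^bsub>G\<^esub>" "f s = (1, True) # v @ [(1, False)]"
    using p.kernel_contains_bracketed_word[OF assms(1) S f, of 1 2] by auto
  obtain r w where r: "r \<in> S" "q r = \<one>\<^bsub>K\<^esub>" "f r = (2, True) # w @ [(2, False)]"
    using q.kernel_contains_bracketed_word[OF assms(2) S f, of 2 1] by auto
  have mult: "f (a \<otimes>\<^bsub>M\<^esub> b) = f a \<otimes>\<^bsub>F\<^sub>2\<^esub> f b" "f a \<in> carrier F\<^sub>2" if "a \<in> S" "b \<in> S" for a b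
    using f that by (auto simp: iso_def hom_def)
  have carr: "s \<in> carrier M" "r \<in> carrier M" using S s r by (auto dest: subgroup.mem_carrier)
  then have "s \<otimes>\<^bsub>M\<^esub> r = r \<otimes>\<^bsub>M\<^esub> s"
    using s(2) r(2) by (intro pq_eqI) auto
  then have comm: "f s \<otimes>\<^bsub>F\<^sub>2\<^esub> f r = f r \<otimes>\<^bsub>F\<^sub>2\<^esub> f s"
    using mult s(1) r(1) by metis
  have "freely_reduced (f s)" "freely_reduced (f r)"
    using mult s(1) r(1) by (auto simp: free_group_def)
  moreover have "hd (f s) = (1, True)" "last (f s) = (1, False)" "hd (f r) = (2, True)" "last (f r) = (2, False)"
    by (simp_all add: s(3) r(3))
  ultimately have "freely_reduced (f s @ f r)" "freely_reduced (f r @ f s)"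
    by (auto simp: freely_reduced_def inv_letter_def successively_append_iff)
  then have "f s @ f r = f r @ f s"
    using comm by (simp add: free_group_def foldr_cancel_cons_reduced)
  then show False by (simp add: s(3) r(3))
qed


section \<open>Laws and amenability in direct products\<close>

lemma (in group_hom) word_eval_hom:
  assumes "\<And>i. a i \<in> carrier G"
  shows "h (word_eval G a w) = word_eval H (h \<circ> a) w \<and> word_eval G a w \<in> carrier G"
  unfolding word_eval_def by (induction w) (use assms in auto)

locale direct_product_decomposition = subdirect_product +
  assumes pq_surj: "(\<lambda>x. (p x, q x)) ` carrier M = carrier G \<times> carrier K"
begin

lemma pq_preimage:
  assumes "g \<in> carrier G" and "k \<in> carrier K"
  shows "\<exists>x\<in>carrier M. p x = g \<and> q x = k"
proof -
  have "(g, k) \<in> (\<lambda>x. (p x, q x)) ` carrier M" unfolding pq_surj using assms by simp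
  then show ?thesis by auto
qed

lemma satisfies_no_law_product:
  assumes "satisfies_no_law G"
  shows "satisfies_no_law M"
  unfolding satisfies_no_law_def
proof (intro allI impI)
  fix w :: "nat word" assume "freely_reduced w" "w \<noteq> []"
  then obtain a where a: "\<And>i. a i \<in> carrier G" "word_eval G a w \<noteq> \<one>\<^bsub>G\<^esub>"
    using assms by (auto simp: satisfies_no_law_def)
  obtain b where b: "\<And>i. b i \<in> carrier M \<and> p (b i) = a i"
    using pq_preimage[OF a(1) K.one_closed] by metis
  then have "p \<circ> b = a" by auto
  then have "p (word_eval M b w) = word_eval G a w"
    using p.word_eval_hom[of b w] b by simp
  then have "word_eval M b w \<noteq> \<one>\<^bsub>M\<^esub>" using a(2) p.hom_one by metis
  then show "\<exists>b. (\<forall>i. b i \<in> carrier M) \<and> word_eval M b w \<noteq> \<one>\<^bsub>M\<^esub>" using b by blast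
qed

end

lemma bounded_on_iff: "bounded_on A f \<longleftrightarrow> (\<exists>c. \<forall>x\<in>A. \<bar>f x\<bar> \<le> c)"
  by (simp add: bounded_on_def bounded_iff)

lemma bounded_on_add:
  assumes "bounded_on A f" and "bounded_on A h"
  shows "bounded_on A (\<lambda>x. f x + h x)"
proof -
  obtain c where c: "\<forall>x\<in>A. \<bar>f x\<bar> \<le> c" using assms(1) unfolding bounded_on_iff ..
  obtain d where d: "\<forall>x\<in>A. \<bar>h x\<bar> \<le> d" using assms(2) unfolding bounded_on_iff ..
  have "\<bar>f x + h x\<bar> \<le> c + d" if "x \<in> A" for x
    using bspec[OF c that] bspec[OF d that] by linarith
  then show ?thesis unfolding bounded_on_iff by blast
qed

lemma bounded_on_scale:
  assumes "bounded_on A f"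
  shows "bounded_on A (\<lambda>x. c * f x)"
proof -
  obtain d where "\<forall>x\<in>A. \<bar>f x\<bar> \<le> d" using assms unfolding bounded_on_iff ..
  then have "\<forall>x\<in>A. \<bar>c * f x\<bar> \<le> \<bar>c\<bar> * d" by (simp add: abs_mult mult_left_mono)
  then show ?thesis unfolding bounded_on_iff by blast
qed

text \<open>
  A mean is applied to total functions on the type, but by \<open>cong\<close> its value at a bounded
  function depends on the restriction to the carrier alone.
\<close>

locale mean = 
  fixes G :: "('a, 'm) monoid_scheme" and \<mu> :: "('a \<Rightarrow> real) \<Rightarrow> real"
  assumes mean: "left_invariant_mean G \<mu>"
begin

lemma add: "bounded_on (carrier G) f \<Longrightarrow> bounded_on (carrier G) h \<Longrightarrow> \<mu> (\<lambda>x. f x + h x) = \<mu> f + \<mu> h"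
  and scale: "bounded_on (carrier G) f \<Longrightarrow> \<mu> (\<lambda>x. c * f x) = c * \<mu> f"
  and nonneg: "bounded_on (carrier G) f \<Longrightarrow> (\<And>x. x \<in> carrier G \<Longrightarrow> 0 \<le> f x) \<Longrightarrow> 0 \<le> \<mu> f"
  and total: "\<mu> (\<lambda>x. 1) = 1"
  and invariant: "g \<in> carrier G \<Longrightarrow> bounded_on (carrier G) f \<Longrightarrow> \<mu> (\<lambda>x. f (g \<otimes>\<^bsub>G\<^esub> x)) = \<mu> f"
  using mean by (simp_all add: left_invariant_mean_def)

lemma const: "\<mu> (\<lambda>x. c) = c"
  using scale[of "\<lambda>x. 1" c] total by (auto simp: bounded_on_iff)

lemma mono:
  assumes "bounded_on (carrier G) f" and "bounded_on (carrier G) h"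
    and "\<And>x. x \<in> carrier G \<Longrightarrow> f x \<le> h x"
  shows "\<mu> f \<le> \<mu> h"
proof -
  have b: "bounded_on (carrier G) (\<lambda>x. (-1) * f x)" using assms(1) by (rule bounded_on_scale)
  have "0 \<le> \<mu> (\<lambda>x. h x + (-1) * f x)"
    by (rule nonneg[OF bounded_on_add[OF assms(2) b]]) (use assms(3) in simp)
  also have "\<dots> = \<mu> h + \<mu> (\<lambda>x. (-1) * f x)" by (rule add[OF assms(2) b])
  also have "\<dots> = \<mu> h + (-1) * \<mu> f" by (simp only: scale[OF assms(1)])
  finally show ?thesis by simp
qed

lemma cong:
  assumes "bounded_on (carrier G) f" and "\<And>x. x \<in> carrier G \<Longrightarrow> f x = h x"
  shows "\<mu> f = \<mu> h"
proof -
  have "bounded_on (carrier G) h" using assms by (simp add: bounded_on_iff)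
  then show ?thesis using assms by (intro antisym mono) auto
qed

lemma abs_le:
  assumes "\<And>x. x \<in> carrier G \<Longrightarrow> \<bar>f x\<bar> \<le> c"
  shows "\<bar>\<mu> f\<bar> \<le> c"
proof -
  have b: "bounded_on (carrier G) f" "bounded_on (carrier G) (\<lambda>x. d)" for d
    using assms by (auto simp: bounded_on_iff)
  have "\<mu> f \<le> c" using mono[OF b, of c] assms const by fastforce
  moreover have "-c \<le> \<mu> f" using mono[OF b(2) b(1), of "-c"] assms const[of "-c"] by fastforce
  ultimately show ?thesis by simp
qed

end

text \<open>
  Averaging first over \<open>K\<close> and then over \<open>G\<close> is an invariant mean on the product: translation by
  \<open>m\<close> acts as translation by \<open>q m\<close> in the inner mean and by \<open>p m\<close> in the outer mean.
\<close>

lemma (in direct_product_decomposition) amenable_product: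
  assumes "amenable G" and "amenable K"
  shows "amenable M"
proof -
  obtain \<mu> \<nu> where \<mu>\<nu>: "left_invariant_mean G \<mu>" "left_invariant_mean K \<nu>"
    using assms by (auto simp: amenable_def)
  interpret \<mu>: mean G \<mu> by unfold_locales (rule \<mu>\<nu>)
  interpret \<nu>: mean K \<nu> by unfold_locales (rule \<mu>\<nu>)
  obtain e where e: "\<And>g k. g \<in> carrier G \<Longrightarrow> k \<in> carrier K \<Longrightarrow> e g k \<in> carrier M \<and> p (e g k) = g \<and> q (e g k) = k"
    using pq_preimage by metis
  define \<rho> where "\<rho> f = \<mu> (\<lambda>g. \<nu> (\<lambda>k. f (e g k)))" for f
  have inner: "bounded_on (carrier K) (\<lambda>k. f (e g k))" 
    if "bounded_on (carrier M) f" "g \<in> carrier G" for f g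
    using that e unfolding bounded_on_iff by blast
  have outer: "bounded_on (carrier G) (\<lambda>g. \<nu> (\<lambda>k. f (e g k)))" if "bounded_on (carrier M) f" for f
    using that e \<nu>.abs_le unfolding bounded_on_iff by meson
  have "\<rho> (\<lambda>x. f x + h x) = \<rho> f + \<rho> h"
    if f: "bounded_on (carrier M) f" and h: "bounded_on (carrier M) h" for f h
  proof -
    have "\<rho> (\<lambda>x. f x + h x) = \<mu> (\<lambda>g. \<nu> (\<lambda>k. f (e g k)) + \<nu> (\<lambda>k. h (e g k)))"
      unfolding \<rho>_def using outer[OF bounded_on_add[OF f h]]
      by (intro \<mu>.cong \<nu>.add inner f h) auto
    also have "\<dots> = \<rho> f + \<rho> h"
      unfolding \<rho>_def by (intro \<mu>.add outer f h)
    finally show ?thesis .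
  qed
  moreover have "\<rho> (\<lambda>x. c * f x) = c * \<rho> f" if f: "bounded_on (carrier M) f" for c f
  proof -
    have "\<rho> (\<lambda>x. c * f x) = \<mu> (\<lambda>g. c * \<nu> (\<lambda>k. f (e g k)))"
      unfolding \<rho>_def using outer[OF bounded_on_scale[OF f]] by (intro \<mu>.cong \<nu>.scale inner f) auto
    also have "\<dots> = c * \<rho> f" unfolding \<rho>_def by (intro \<mu>.scale outer f)
    finally show ?thesis .
  qed
  moreover have "0 \<le> \<rho> f" if "bounded_on (carrier M) f" "\<forall>x\<in>carrier M. 0 \<le> f x" for f
    unfolding \<rho>_def using that e by (intro \<mu>.nonneg \<nu>.nonneg outer inner) auto
  moreover have "\<rho> (\<lambda>x. 1) = 1"
    by (simp add: \<rho>_def \<mu>.total \<nu>.total)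
  moreover have "\<rho> (\<lambda>x. f (m \<otimes>\<^bsub>M\<^esub> x)) = \<rho> f" if m: "m \<in> carrier M" and f: "bounded_on (carrier M) f" for m f
  proof -
    let ?F = "\<lambda>g. \<nu> (\<lambda>k. f (e g k))"
    have e_mult: "e (p m \<otimes>\<^bsub>G\<^esub> g) (q m \<otimes>\<^bsub>K\<^esub> k) = m \<otimes>\<^bsub>M\<^esub> e g k" if "g \<in> carrier G" "k \<in> carrier K" for g k
      using that m e by (intro pq_eqI) auto
    have "\<nu> (\<lambda>k. f (m \<otimes>\<^bsub>M\<^esub> e g k)) = ?F (p m \<otimes>\<^bsub>G\<^esub> g)" if g: "g \<in> carrier G" for g
    proof -
      have pg: "p m \<otimes>\<^bsub>G\<^esub> g \<in> carrier G" using g m by simp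
      have "?F (p m \<otimes>\<^bsub>G\<^esub> g) = \<nu> (\<lambda>k. f (e (p m \<otimes>\<^bsub>G\<^esub> g) (q m \<otimes>\<^bsub>K\<^esub> k)))"
        using \<nu>.invariant[OF _ inner[OF f pg], of "q m"] m by simp
      also have "\<dots> = \<nu> (\<lambda>k. f (m \<otimes>\<^bsub>M\<^esub> e g k))"
      proof (rule \<nu>.cong)
        show "bounded_on (carrier K) (\<lambda>k. f (e (p m \<otimes>\<^bsub>G\<^esub> g) (q m \<otimes>\<^bsub>K\<^esub> k)))"
          using inner[OF f pg] m unfolding bounded_on_iff by (meson K.m_closed q.hom_closed)
      qed (use e_mult g in simp)
      finally show ?thesis by simp
    qed
    moreover have "bounded_on (carrier G) (\<lambda>g. ?F (p m \<otimes>\<^bsub>G\<^esub> g))"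
      using outer[OF f] m unfolding bounded_on_iff by (meson G.m_closed p.hom_closed)
    ultimately have "\<rho> (\<lambda>x. f (m \<otimes>\<^bsub>M\<^esub> x)) = \<mu> (\<lambda>g. ?F (p m \<otimes>\<^bsub>G\<^esub> g))"
      unfolding \<rho>_def by (intro \<mu>.cong[symmetric]) auto
    also have "\<dots> = \<rho> f"
      unfolding \<rho>_def using m by (intro \<mu>.invariant outer f) auto
    finally show ?thesis .
  qed
  ultimately have "left_invariant_mean M \<rho>"
    unfolding left_invariant_mean_def by blast
  then show ?thesis by (auto simp: amenable_def)
qed

lemma group_property_direct_product:
  fixes M G K :: "'a monoid"
  assumes "P \<in> group_properties" and "P \<noteq> sofic"
    and "direct_product_decomposition M G K p q" and "P G" and "P K"
  shows "P M"
proof -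
  interpret direct_product_decomposition M G K p q by (rule assms(3))
  show ?thesis
    using assms(1,2,4,5) amenable_product no_free_subgroup_subdirect left_orderable_subdirect
      locally_indicable_subdirect biorderable_subdirect unique_product_subdirect torsion_free_subdirect
      satisfies_no_law_product
    unfolding group_properties_def by (elim insertE) simp_all
qed

lemma (in direct_product_decomposition) right_factor_embeds:
  "\<exists>t. partial_embedding K M (carrier K) t"
proof -
  obtain t where t: "\<And>k. k \<in> carrier K \<Longrightarrow> t k \<in> carrier M \<and> p (t k) = \<one>\<^bsub>G\<^esub> \<and> q (t k) = k"
    using pq_preimage[OF G.one_closed] by metis
  have "t (k \<otimes>\<^bsub>K\<^esub> l) = t k \<otimes>\<^bsub>M\<^esub> t l" if "k \<in> carrier K" "l \<in> carrier K" for k l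
    using that t by (intro pq_eqI) auto
  moreover have "inj_on t (carrier K)" using t by (metis inj_onI)
  ultimately show ?thesis using t by (auto simp: partial_embedding_def)
qed

lemma partial_embedding_subset:
  "partial_embedding K M A t \<Longrightarrow> B \<subseteq> A \<Longrightarrow> partial_embedding K M B t"
  unfolding partial_embedding_def by (meson image_mono inj_on_subset order_trans subsetD)

section \<open>The space of enumerated groups\<close>

lemma bij_betw_extending:
  assumes A: "countable A" "infinite A" and B: "countable B" "infinite B"
    and F: "finite F" "F \<subseteq> A" "inj_on f F" "f ` F \<subseteq> B"
  shows "\<exists>\<beta>. bij_betw \<beta> A B \<and> (\<forall>x\<in>F. \<beta> x = f x)"
proof -
  have "bij_betw (to_nat_on (A - F)) (A - F) UNIV"
    using A F(1) by (intro to_nat_on_infinite) auto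
  moreover have "bij_betw (from_nat_into (B - f ` F)) UNIV (B - f ` F)"
    using B F(1) by (intro bij_betw_from_nat_into) auto
  ultimately obtain g where g: "bij_betw g (A - F) (B - f ` F)"
    using bij_betw_trans by blast
  have "bij_betw f F (f ` F)" using F(3) by (simp add: bij_betw_def)
  then have "bij_betw (\<lambda>x. if x \<in> F then f x else g x) (F \<union> (A - F)) (f ` F \<union> (B - f ` F))"
    using g by (rule bij_betw_disjoint_Un) auto
  moreover have "F \<union> (A - F) = A" "f ` F \<union> (B - f ` F) = B" using F by auto
  ultimately show ?thesis by (intro exI[of _ "\<lambda>x. if x \<in> F then f x else g x"]) simp
qed

lemma product_discrete_neighbourhood:
  assumes "openin (product_topology (\<lambda>_. discrete_topology D) I) V" and "f \<in> V"
  shows "\<exists>J. finite J \<and> J \<subseteq> I \<and> (\<forall>g \<in> I \<rightarrow>\<^sub>E D. (\<forall>j\<in>J. g j = f j) \<longrightarrow> g \<in> V)"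
proof -
  obtain U where U: "finite {i \<in> I. U i \<noteq> D}" "f \<in> Pi\<^sub>E I U" "Pi\<^sub>E I U \<subseteq> V"
    using assms unfolding openin_product_topology_alt by fastforce
  have "g \<in> V" if g: "g \<in> I \<rightarrow>\<^sub>E D" "\<forall>j\<in>{i \<in> I. U i \<noteq> D}. g j = f j" for g
  proof -
    have "g i \<in> U i" if "i \<in> I" for i
      using that g U(2) by (cases "U i = D") (auto simp: PiE_iff)
    then have "g \<in> Pi\<^sub>E I U" using g(1) by (auto simp: PiE_iff)
    then show ?thesis using U(3) by blast
  qed
  then show ?thesis using U(1) by (intro exI[of _ "{i \<in> I. U i \<noteq> D}"]) auto
qed

lemma topspace_structure_space:
  "topspace structure_space = ({1..} \<times> {1..} \<rightarrow>\<^sub>E {1..}) \<times> ({1..} \<rightarrow>\<^sub>E {1..}) \<times> {1..}"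
  by (simp add: structure_space_def)

text \<open>
  In a product of discrete spaces a neighbourhood of a point constrains finitely many coordinates;
  \<open>F\<close> collects the numbers that occur as arguments in these coordinates, and the identity is
  kept.
\<close>

lemma structure_space_neighbourhood:
  assumes U: "openin structure_space U" and \<omega>: "(m, i, e) \<in> U"
  shows "\<exists>F. finite F \<and> F \<subseteq> {1..} \<and> (\<forall>m' i'. (m', i', e) \<in> topspace structure_space \<longrightarrow>
    (\<forall>x\<in>F. \<forall>y\<in>F. m' (x, y) = m (x, y)) \<longrightarrow> (\<forall>x\<in>F. i' x = i x) \<longrightarrow> (m', i', e) \<in> U)"
proof -
  obtain U1 W where U1: "openin (product_topology (\<lambda>_. discrete_topology {1..}) ({1..} \<times> {1..})) U1" "m \<in> U1"
    and W: "openin (prod_topology (product_topology (\<lambda>_. discrete_topology {1..}) {1..})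
         (discrete_topology {1..})) W" "(i, e) \<in> W" and sub: "U1 \<times> W \<subseteq> U"
    using U[unfolded structure_space_def openin_prod_topology_alt[of _ "prod_topology _ _"], rule_format, OF \<omega>]
    by (elim exE conjE)
  obtain U2 U3 where U2: "openin (product_topology (\<lambda>_. discrete_topology {1..}) {1..}) U2" "i \<in> U2"
    and U3: "e \<in> U3" and sub': "U2 \<times> U3 \<subseteq> W"
    using W(1)[unfolded openin_prod_topology_alt, rule_format, OF W(2)] by (elim exE conjE)
  obtain J where J: "finite J" "J \<subseteq> {1..} \<times> {1..}"
      "\<forall>g \<in> {1..} \<times> {1..} \<rightarrow>\<^sub>E {1..}. (\<forall>j\<in>J. g j = m j) \<longrightarrow> g \<in> U1"
    using product_discrete_neighbourhood[OF U1] by (elim exE conjE)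
  obtain L where L: "finite L" "L \<subseteq> {1..}"
      "\<forall>g \<in> {1..} \<rightarrow>\<^sub>E {1..}. (\<forall>j\<in>L. g j = i j) \<longrightarrow> g \<in> U2"
    using product_discrete_neighbourhood[OF U2] by (elim exE conjE)
  define F where "F = fst ` J \<union> snd ` J \<union> L"
  have "(m', i', e) \<in> U" if top: "(m', i', e) \<in> topspace structure_space"
    and m': "\<forall>x\<in>F. \<forall>y\<in>F. m' (x, y) = m (x, y)" and i': "\<forall>x\<in>F. i' x = i x" for m' i'
  proof -
    have "m' j = m j" if "j \<in> J" for j
      using m' that unfolding F_def by (metis UnI1 UnI2 image_eqI prod.collapse)
    then have "m' \<in> U1" using J(3) top by (simp add: topspace_structure_space)
    moreover have "i' \<in> U2" using L(3) top i' by (simp add: topspace_structure_space F_def)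
    ultimately show ?thesis using sub sub' U3 by blast
  qed
  moreover have "finite F" "F \<subseteq> {1..}" using J L by (auto simp: F_def)
  ultimately show ?thesis by blast
qed

lemma openin_structure_space_mult:
  assumes "a \<in> {1..}" and "b \<in> {1..}"
  shows "openin structure_space {\<omega> \<in> topspace structure_space. fst \<omega> (a, b) = c}"
proof -
  have "continuous_map structure_space (discrete_topology {1..}) ((\<lambda>f. f (a, b)) \<circ> fst)"
    unfolding structure_space_def
    using assms by (intro continuous_map_compose[OF continuous_map_fst] continuous_map_product_projection) auto
  then have "openin structure_space {\<omega> \<in> topspace structure_space. ((\<lambda>f. f (a, b)) \<circ> fst) \<omega> \<in> {c} \<inter> {1..}}"
    by (rule openin_continuous_map_preimage) auto
  moreover have "fst \<omega> (a, b) \<in> {1..}" if "\<omega> \<in> topspace structure_space" for \<omega>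
  proof -
    have "fst \<omega> \<in> {1..} \<times> {1..} \<rightarrow>\<^sub>E {1..}"
      using that by (simp only: topspace_structure_space mem_Times_iff)
    then show ?thesis by (rule PiE_mem) (use assms in simp)
  qed
  then have "{\<omega> \<in> topspace structure_space. ((\<lambda>f. f (a, b)) \<circ> fst) \<omega> \<in> {c} \<inter> {1..}} =
      {\<omega> \<in> topspace structure_space. fst \<omega> (a, b) = c}" by (intro Collect_cong) auto
  ultimately show ?thesis by simp
qed

lemma group_of_simps [simp]:
  "carrier (group_of (m, i, e)) = {1..}" "mult (group_of (m, i, e)) x y = m (x, y)"
  "one (group_of (m, i, e)) = e"
  by (simp_all add: group_of_def)

text \<open>
  The enumeration \<open>\<beta>\<close> of the product sends \<open>x\<close> to \<open>(x, 1)\<close> for all \<open>x\<close> in the finite set \<open>F'\<close>, which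
  consists of \<open>F\<close>, the values of the operations on \<open>F\<close> and the identity; elsewhere it is any
  bijection onto the remaining pairs. Pulling the operations of the product back along \<open>\<beta>\<close> then reproduces the
  given values on \<open>F\<close>.
\<close>

lemma enumerated_direct_product:
  assumes \<omega>: "(m, i, e) \<in> enumerated_groups" and \<kappa>: "\<kappa> \<in> enumerated_groups"
    and F: "finite F" "F \<subseteq> {1..}"
  shows "\<exists>m' i' p q. (m', i', e) \<in> enumerated_groups \<and>
    (\<forall>x\<in>F. \<forall>y\<in>F. m' (x, y) = m (x, y)) \<and> (\<forall>x\<in>F. i' x = i x) \<and>
    direct_product_decomposition (group_of (m', i', e)) (group_of (m, i, e)) (group_of \<kappa>) p q"
proof -
  define G K where "G = group_of (m, i, e)" and "K = group_of \<kappa>"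
  interpret G: group G using \<omega> by (simp add: G_def enumerated_groups_def)
  interpret K: group K using \<kappa> by (auto simp: K_def enumerated_groups_def)
  have carr: "carrier G = {1..}" "carrier K = {1..}"
    by (simp_all add: G_def K_def group_of_def split: prod.split)
  have G_mult: "x \<otimes>\<^bsub>G\<^esub> y = m (x, y)" and G_one: "\<one>\<^bsub>G\<^esub> = e" for x y
    by (simp_all add: G_def)
  have i: "i x = inv\<^bsub>G\<^esub> x" if "x \<in> {1..}" for x
    using \<omega> that by (auto simp: G_def enumerated_groups_def)
  define F' where "F' = insert e (F \<union> i ` F \<union> m ` (F \<times> F))"
  have m_closed: "m (x, y) \<in> {1..}" if "x \<in> {1..}" "y \<in> {1..}" for x y
    using G.m_closed[of x y] that by (simp add: carr G_mult)
  have i_closed: "i x \<in> {1..}" if "x \<in> {1..}" for x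
    using G.inv_closed[of x] that by (simp add: carr i)
  have F': "finite F'" "F' \<subseteq> {1..}"
    using F m_closed i_closed G.one_closed by (auto simp: F'_def carr G_one subset_iff)
  have "infinite ({1..} :: nat set)" by (rule infinite_Ici)
  then have "\<exists>\<beta>. bij_betw \<beta> {1..} ({1..} \<times> {1..}) \<and> (\<forall>x\<in>F'. \<beta> x = (x, \<one>\<^bsub>K\<^esub>))"
    using F' K.one_closed
    by (intro bij_betw_extending) (auto simp: carr finite_cartesian_product_iff inj_on_def)
  then obtain \<beta> where \<beta>: "bij_betw \<beta> {1..} ({1..} \<times> {1..})"
    and \<beta>_F': "\<And>x. x \<in> F' \<Longrightarrow> \<beta> x = (x, \<one>\<^bsub>K\<^esub>)" by blast
  define \<gamma> where "\<gamma> = inv_into {1..} \<beta>"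
  have \<gamma>: "bij_betw \<gamma> ({1..} \<times> {1..}) {1..}" unfolding \<gamma>_def by (rule bij_betw_inv_into[OF \<beta>])
  have \<beta>\<gamma>: "\<beta> (\<gamma> z) = z" if "z \<in> {1..} \<times> {1..}" for z
    unfolding \<gamma>_def by (rule bij_betw_inv_into_right[OF \<beta> that])
  have \<gamma>\<beta>: "\<gamma> (\<beta> x) = x" if "x \<in> {1..}" for x
    unfolding \<gamma>_def by (rule bij_betw_inv_into_left[OF \<beta> that])
  define P where "P = G \<times>\<times> K"
  interpret P: group P unfolding P_def by (rule DirProd_group) unfold_locales
  have P_carr: "carrier P = {1..} \<times> {1..}" by (simp add: P_def carr)
  have \<beta>_closed: "\<beta> x \<in> carrier P" if "x \<in> {1..}" for x
    using bij_betwE[OF \<beta>] that by (simp add: P_carr)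
  define m' where "m' = (\<lambda>z\<in>{1..} \<times> {1..}. \<gamma> (\<beta> (fst z) \<otimes>\<^bsub>P\<^esub> \<beta> (snd z)))"
  have m': "m' (x, y) = \<gamma> (\<beta> x \<otimes>\<^bsub>P\<^esub> \<beta> y)" if "x \<in> {1..}" "y \<in> {1..}" for x y
    using that by (simp add: m'_def)
  define i' where "i' = (\<lambda>x\<in>{1..}. inv\<^bsub>group_of (m', i, e)\<^esub> x)"
  define M where "M = group_of (m', i', e)"
  have M_eq: "group_of (m', i, e) = M" by (simp add: M_def group_of_def)
  have M_simps: "carrier M = {1..}" "\<one>\<^bsub>M\<^esub> = e" "\<And>x y. x \<otimes>\<^bsub>M\<^esub> y = m' (x, y)"
    by (simp_all add: M_def)
  have \<beta>_m': "\<beta> (m' (x, y)) = \<beta> x \<otimes>\<^bsub>P\<^esub> \<beta> y" if "x \<in> {1..}" "y \<in> {1..}" for x y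
    using that P.m_closed[OF \<beta>_closed \<beta>_closed] by (simp add: m' \<beta>\<gamma> P_carr)
  have \<gamma>_F': "\<gamma> (x, \<one>\<^bsub>K\<^esub>) = x" if "x \<in> F'" for x
    using \<gamma>\<beta>[of x] \<beta>_F'[OF that] that F'(2) by auto
  have "\<gamma> \<in> iso P M"
  proof -
    have "\<gamma> (x \<otimes>\<^bsub>P\<^esub> y) = \<gamma> x \<otimes>\<^bsub>M\<^esub> \<gamma> y" if "x \<in> carrier P" "y \<in> carrier P" for x y
    proof -
      have "\<gamma> x \<in> {1..}" "\<gamma> y \<in> {1..}" using that bij_betwE[OF \<gamma>] unfolding P_carr by blast+
      from m'[OF this] show ?thesis using that by (simp only: M_simps \<beta>\<gamma> P_carr)
    qed
    then show ?thesis
      using \<gamma> by (auto simp: iso_def hom_def P_carr M_simps bij_betw_def)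
  qed
  then have "group (M\<lparr>one := \<gamma> \<one>\<^bsub>P\<^esub>\<rparr>)" by (rule P.iso_imp_img_group)
  moreover have "\<gamma> \<one>\<^bsub>P\<^esub> = \<one>\<^bsub>M\<^esub>"
    using \<gamma>_F'[of e] by (simp add: P_def M_simps G_one F'_def)
  ultimately have "group M" by (simp add: M_def group_of_def)
  then interpret M: group M .
  have i': "i' x = inv\<^bsub>M\<^esub> x" if "x \<in> {1..}" for x
    using that by (simp add: i'_def M_eq)
  have "m' (x, y) \<in> {1..}" if "x \<in> {1..}" "y \<in> {1..}" for x y
    using M.m_closed[of x y] that by (simp add: M_simps)
  moreover have "i' x \<in> {1..}" if "x \<in> {1..}" for x
    using M.inv_closed[of x] that by (simp add: i' M_simps)
  ultimately have "m' \<in> {1..} \<times> {1..} \<rightarrow>\<^sub>E {1..}" "i' \<in> {1..} \<rightarrow>\<^sub>E {1..}" 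
    by (auto simp: m'_def i'_def PiE_iff)
  moreover have "e \<in> {1..}" using M.one_closed by (simp add: M_simps)
  ultimately have top: "(m', i', e) \<in> topspace structure_space"
    by (simp add: topspace_structure_space)
  have "(m', i', e) \<in> enumerated_groups"
    unfolding enumerated_groups_def using top i' \<open>group M\<close> by (simp add: M_def[symmetric])
  moreover have m'_F: "m' (x, y) = m (x, y)" if "x \<in> F'" "y \<in> F'" "m (x, y) \<in> F'" for x y
  proof -
    have "m' (x, y) = \<gamma> (m (x, y), \<one>\<^bsub>K\<^esub>)"
      using m'[of x y] that(1,2) F'(2) by (auto simp: \<beta>_F' P_def G_mult)
    then show ?thesis using \<gamma>_F'[OF that(3)] by simp
  qed
  then have "\<forall>x\<in>F. \<forall>y\<in>F. m' (x, y) = m (x, y)" by (auto simp: F'_def)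
  moreover have "i' x = i x" if x: "x \<in> F" for x
  proof -
    have x': "x \<in> {1..}" "i x \<in> {1..}" using x F(2) i_closed by auto
    have "m (i x, x) = e" using G.l_inv[of x] x' by (simp add: carr i G_mult G_one)
    then have "i x \<otimes>\<^bsub>M\<^esub> x = \<one>\<^bsub>M\<^esub>"
      using m'_F[of "i x" x] x by (simp add: M_simps F'_def)
    then have "inv\<^bsub>M\<^esub> x = i x" using x' by (intro M.inv_equality) (simp_all add: M_simps)
    then show ?thesis using i' x' by simp
  qed
  moreover have "direct_product_decomposition M G K (fst \<circ> \<beta>) (snd \<circ> \<beta>)"
  proof unfold_locales
    show "fst \<circ> \<beta> \<in> hom M G" "snd \<circ> \<beta> \<in> hom M K"
      using \<beta>_closed by (auto simp: hom_def M_simps \<beta>_m' P_def mult_DirProd' mem_Times_iff)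
    show "inj_on (\<lambda>x. ((fst \<circ> \<beta>) x, (snd \<circ> \<beta>) x)) (carrier M)"
      "(\<lambda>x. ((fst \<circ> \<beta>) x, (snd \<circ> \<beta>) x)) ` carrier M = carrier G \<times> carrier K"
      using \<beta> by (simp_all add: M_simps carr bij_betw_def)
  qed
  ultimately show ?thesis
    unfolding M_def G_def K_def by blast
qed

lemma topspace_enumerated_groups_space:
  "topspace (enumerated_groups_space P) = {\<omega> \<in> enumerated_groups. P (group_of \<omega>)}"
  by (auto simp: enumerated_groups_space_def enumerated_groups_def)

text \<open>
  For a fixed map \<open>t\<close> the condition prescribes the multiplication at the finitely many pairs
  \<open>(t x, t y)\<close>; the set in question is the union of these open sets over all
  injective \<open>t\<close>.
\<close>

lemma openin_partially_embedding:
  assumes B: "finite B"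
  shows "openin (enumerated_groups_space P)
    {\<omega> \<in> topspace (enumerated_groups_space P). \<exists>t. partial_embedding K (group_of \<omega>) B t}"
proof -
  define I where "I = {z \<in> B \<times> B. fst z \<otimes>\<^bsub>K\<^esub> snd z \<in> B}"
  define A where "A t = (\<Inter>z\<in>I. {\<omega> \<in> topspace structure_space.
      fst \<omega> (t (fst z), t (snd z)) = t (fst z \<otimes>\<^bsub>K\<^esub> snd z)}) \<inter> topspace structure_space" for t
  have fin: "finite I" using B by (simp add: I_def)
  have "openin structure_space (A t)" if "t ` B \<subseteq> {1..}" for t
    unfolding A_def
  proof (rule openin_INT[OF fin])
    fix z assume "z \<in> I"
    then have "t (fst z) \<in> {1..}" "t (snd z) \<in> {1..}" using that by (auto simp: I_def)
    then show "openin structure_space {\<omega> \<in> topspace structure_space.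
        fst \<omega> (t (fst z), t (snd z)) = t (fst z \<otimes>\<^bsub>K\<^esub> snd z)}"
      by (rule openin_structure_space_mult)
  qed
  then have "openin structure_space (\<Union>t\<in>{t. t ` B \<subseteq> {1..} \<and> inj_on t B}. A t)"
    by (intro openin_Union) auto
  moreover have *: "partial_embedding K (group_of \<omega>) B t \<longleftrightarrow> t ` B \<subseteq> {1..} \<and> inj_on t B \<and> \<omega> \<in> A t"
    if "\<omega> \<in> topspace structure_space" for \<omega> t
    using that by (cases \<omega>) (auto simp: partial_embedding_def A_def I_def)
  then have "{\<omega> \<in> topspace (enumerated_groups_space P). \<exists>t. partial_embedding K (group_of \<omega>) B t} =
      (\<Union>t\<in>{t. t ` B \<subseteq> {1..} \<and> inj_on t B}. A t) \<inter> {\<omega> \<in> enumerated_groups. P (group_of \<omega>)}"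
  proof -
    have "enumerated_groups \<subseteq> topspace structure_space" by (auto simp: enumerated_groups_def)
    with * show ?thesis unfolding topspace_enumerated_groups_space by blast
  qed
  ultimately show ?thesis
    unfolding enumerated_groups_space_def openin_subtopology by blast
qed

text \<open>
  Around a group \<open>G\<close> with the property \<open>P\<close>, a suitable enumeration of the product of \<open>G\<close> and the group
  of \<open>\<kappa>\<close> is as close to \<open>G\<close> as desired, and it contains the second factor.
\<close>

lemma dense_partially_embedding:
  assumes P: "P \<in> group_properties" "P \<noteq> sofic"
    and \<kappa>: "\<kappa> \<in> topspace (enumerated_groups_space P)" and B: "B \<subseteq> carrier (group_of \<kappa>)"
  shows "enumerated_groups_space P closure_of {\<omega> \<in> topspace (enumerated_groups_space P).
      \<exists>t. partial_embedding (group_of \<kappa>) (group_of \<omega>) B t} = topspace (enumerated_groups_space P)"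
  unfolding dense_intersects_open
proof (intro allI impI)
  fix V assume V_open: "openin (enumerated_groups_space P) V \<and> V \<noteq> {}"
  then obtain U where U: "openin structure_space U"
    and V: "V = U \<inter> {\<omega> \<in> enumerated_groups. P (group_of \<omega>)}"
    unfolding enumerated_groups_space_def openin_subtopology by (elim conjE exE)
  obtain m i e where "(m, i, e) \<in> V" using V_open by fastforce
  then have \<omega>: "(m, i, e) \<in> U" "(m, i, e) \<in> enumerated_groups" "P (group_of (m, i, e))"
    unfolding V by auto
  have \<kappa>': "\<kappa> \<in> enumerated_groups" "P (group_of \<kappa>)"
    using \<kappa> by (auto simp: topspace_enumerated_groups_space)
  obtain F where F: "finite F" "F \<subseteq> {1..}" and F_U: "\<And>m' i'. (m', i', e) \<in> topspace structure_space \<Longrightarrow>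
      \<forall>x\<in>F. \<forall>y\<in>F. m' (x, y) = m (x, y) \<Longrightarrow> \<forall>x\<in>F. i' x = i x \<Longrightarrow> (m', i', e) \<in> U"
    using structure_space_neighbourhood[OF U \<omega>(1)] by metis
  obtain m' i' p q where \<mu>: "(m', i', e) \<in> enumerated_groups"
      "\<forall>x\<in>F. \<forall>y\<in>F. m' (x, y) = m (x, y)" "\<forall>x\<in>F. i' x = i x"
    and dec: "direct_product_decomposition (group_of (m', i', e)) (group_of (m, i, e)) (group_of \<kappa>) p q"
    using enumerated_direct_product[OF \<omega>(2) \<kappa>'(1) F] by (elim exE conjE)
  have "(m', i', e) \<in> topspace structure_space" using \<mu>(1) by (simp add: enumerated_groups_def)
  then have "(m', i', e) \<in> U" using F_U \<mu>(2,3) by blast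
  moreover have P_\<mu>: "P (group_of (m', i', e))"
    by (rule group_property_direct_product[OF P dec \<omega>(3) \<kappa>'(2)])
  moreover have "\<exists>t. partial_embedding (group_of \<kappa>) (group_of (m', i', e)) B t"
    using direct_product_decomposition.right_factor_embeds[OF dec] partial_embedding_subset[OF _ B] by blast
  ultimately have "(m', i', e) \<in> {\<omega> \<in> topspace (enumerated_groups_space P).
      \<exists>t. partial_embedding (group_of \<kappa>) (group_of \<omega>) B t} \<inter> V"
    using \<mu>(1) by (simp add: V topspace_enumerated_groups_space)
  then show "{\<omega> \<in> topspace (enumerated_groups_space P).
      \<exists>t. partial_embedding (group_of \<kappa>) (group_of \<omega>) B t} \<inter> V \<noteq> {}" by blast
qed

theorem corollary1p3p7:
  fixes P :: "nat monoid \<Rightarrow> bool"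
  assumes "P \<in> group_properties"
  shows "(\<forall>\<omega> \<in> topspace (enumerated_groups_space P). sofic (group_of \<omega>)) \<or>
         (\<exists>C. comeager_in (enumerated_groups_space P) C \<and> (\<forall>\<omega>\<in>C. \<not> sofic (group_of \<omega>)))"
proof (rule disjCI)
  let ?X = "enumerated_groups_space P"
  assume no: "\<not> (\<exists>C. comeager_in ?X C \<and> (\<forall>\<omega>\<in>C. \<not> sofic (group_of \<omega>)))"
  show "\<forall>\<omega> \<in> topspace ?X. sofic (group_of \<omega>)"
  proof (rule ccontr)
    assume "\<not> (\<forall>\<omega> \<in> topspace ?X. sofic (group_of \<omega>))"
    then obtain \<kappa> where \<kappa>: "\<kappa> \<in> topspace ?X" "\<not> sofic (group_of \<kappa>)" by blast
    then have "P \<noteq> sofic" by (auto simp: topspace_enumerated_groups_space)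
    have grp: "group (group_of \<omega>)" if "\<omega> \<in> topspace ?X" for \<omega>
      using that by (auto simp: topspace_enumerated_groups_space enumerated_groups_def)
    obtain B where B: "finite B" "B \<subseteq> carrier (group_of \<kappa>)"
      and nonsofic: "\<forall>(M :: nat monoid) t. group M \<longrightarrow> partial_embedding (group_of \<kappa>) M B t \<longrightarrow> \<not> sofic M"
      using group.nonsofic_finite_obstruction[where 'c = nat and 'n = unit, OF grp[OF \<kappa>(1)] \<kappa>(2)] by (elim exE conjE)
    let ?C = "{\<omega> \<in> topspace ?X. \<exists>t. partial_embedding (group_of \<kappa>) (group_of \<omega>) B t}"
    have "openin ?X ?C" by (rule openin_partially_embedding[OF B(1)])
    moreover have "?X closure_of ?C = topspace ?X"
      by (rule dense_partially_embedding[OF assms \<open>P \<noteq> sofic\<close> \<kappa>(1) B(2)])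
    ultimately have "comeager_in ?X ?C"
      unfolding comeager_in_def by (intro conjI exI[of _ "{?C}"]) auto
    moreover have "\<forall>\<omega>\<in>?C. \<not> sofic (group_of \<omega>)" using nonsofic grp by blast
    ultimately show False using no by blast
  qed
qed

end
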